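(* For $k\ge 0$ and $0\le j\le 2^{\lfloor k/2\rfloor+1}-2$, the atom $W(k,j)$ of the Binary Two-Up Sequence consists of the terms $a(n)$ to $a(n+5)$, where $n=12\mu(k+4)+12j+7$. Let $m=(n+3)/2$. Then $a(m)$ is a weight $2$ term in an earlier atom of type $V$, $W$, or $X$. Let $a(m)=2^x+2^y$ where $x>y$. Then $x=2\mu(k+4)+2j+2$, $$a(n)=2^{x-1}+2^{2x-1},\ a(n+1)=2^{4x-2},\ a(n+2)=2^{4x-1},\ a(n+3)=2^{4x},\ a(n+4)=2^{y}+2^{2x},\ a(n+5)=2^{4x+1}.$$ The term after $W(k,j)$ ends is $a(n+6)=2^{x}+2^{2x+1}$.
   Context: Two nonnegative integers are perpendicular if their binary expansions have no $1$ in the same bit-position. The Binary Two-Up Sequence $\{a(n)\}_{n\ge 0}$ is defined by: for each $n\ge 0$, $a(n)$ is the smallest nonnegative integer not among $a(0),\ldots,a(n-1)$ that is perpendicular to each of $a(\lceil n/2\rceil),\ldots,a(n-1)$, i.e. to each of the previous $\lfloor n/2\rfloor$ terms. It begins $0,1,2,4,8,3,16,32,64,12,128,\ldots$. The initial term $a(0)=0$ is ignored in the decomposition below. The weight of a nonnegative integer is the number of $1$'s in its binary expansion. $\mu(m)$, $m\ge 1$, denotes the $m$-th term, in increasing order, of the sequence of all numbers of the form $2^i$ ($i\ge0$) or $3\cdot 2^i$ ($i\ge 0$): $\mu(1),\mu(2),\ldots = 1,2,3,4,6,8,12,16,24,32,48,64,\ldots$. Free $1$'s. When $n=2t$ is even,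 once $a(2t)$ has been determined the powers of $2$ in the binary expansion of $a(t)$ are "freed". Thus the free powers of $2$ after step $n$ are the $2^e$ which occur in the binary expansion of some $a(i)$, $1\le i\le n$, but of none of the terms $a(\lceil (n+1)/2\rceil),\ldots,a(n)$. Atoms. The sequence $a(1),a(2),\ldots$ is cut into consecutive blocks called atoms: an atom ends with the term $a(n)$ exactly when, after step $n$ (including the freeing, if $n$ is even), there are exactly two distinct free powers of $2$ and their sum is a number not among $a(1),\ldots,a(n)$. The code of an atom is obtained by going through its terms $a(i)$ in order and writing $Aw$, where $w$ is the weight of $a(i)$, followed, if $i=2t$ is even, by $Fw'$, where $w'$ is the weight of the freed term $a(t)$. The relevant types of atoms are defined by their codes: $V = A2\,A1\,F2\,A1\,A1\,F1\,A2\,A1\,F1$ ($6$ terms); $W = A2\,A1\,F1\,A1\,A1\,F2\,A2\,A1\,F1$ ($6$ terms); $X = A2\,A1\,F2\,A1\,A1\,F1\,A2\,A1\,F2\,A2\,A1\,F1$ ($8$ terms). The first atom of type $W$ (terms $a(15),\ldots,a(20)$) is labeled $W(-1)$; the subsequent atoms of type $W$ are labeled, in order of occurrence in the sequence, $W(k,j)$ with $k\ge 0$, $0\le j\le 2^{\lfloor k/2\rfloor+1}-2$, in lexicographic order of $(k,j)$: $W(0,0),W(1,0),W(2,0),W(2,1),W(2,2),W(3,0),W(3,1),W(3,2),W(4,0),\ldots$. *)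

theory Defs
  imports "HOL-Library.Infinite_Set"
begin

definition perpendicular :: "nat \<Rightarrow> nat \<Rightarrow> bool" where
  "perpendicular x y \<longleftrightarrow> (\<nexists>i. bit x i \<and> bit y i)"

definition weight :: "nat \<Rightarrow> nat" where
  "weight x = card {i. bit x i}"

(* The Binary Two-Up Sequence; (n + 1) div 2 is the ceiling of n/2. *)
fun two_up :: "nat \<Rightarrow> nat" where
  "two_up n = (LEAST x. x \<notin> two_up ` {..<n} \<and>
                        (\<forall>i \<in> {(n + 1) div 2..<n}. perpendicular x (two_up i)))"

declare two_up.simps [simp del]

(* Counting starts at 1: mu 1 = 1. The value mu 0 is meaningless. *)
definition mu :: "nat \<Rightarrow> nat" where
  "mu m = enumerate ({2 ^ i | i. True} \<union> {3 * 2 ^ i | i. True}) (m - 1)"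

(* The powers of 2 that are free after step n; n div 2 + 1 is the ceiling of (n + 1)/2. *)
definition free_powers :: "nat \<Rightarrow> nat set" where
  "free_powers n = {2 ^ e | e. (\<exists>i \<in> {1..n}. bit (two_up i) e) \<and>
                               (\<forall>i \<in> {n div 2 + 1..n}. \<not> bit (two_up i) e)}"

definition atom_end :: "nat \<Rightarrow> bool" where
  "atom_end n \<longleftrightarrow> n \<ge> 1 \<and> card (free_powers n) = 2 \<and> \<Sum>(free_powers n) \<notin> two_up ` {1..n}"

(* An atom is given by the indices p and q of its first and last terms. *)
definition is_atom :: "nat \<Rightarrow> nat \<Rightarrow> bool" where
  "is_atom p q \<longleftrightarrow> 1 \<le> p \<and> p \<le> q \<and> (p = 1 \<or> atom_end (p - 1)) \<and>
                   (\<forall>i \<in> {p..<q}. \<not> atom_end i) \<and> atom_end q"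

datatype code_symbol = A nat | F nat

definition atom_code :: "nat \<Rightarrow> nat \<Rightarrow> code_symbol list" where
  "atom_code p q = concat (map (\<lambda>i. A (weight (two_up i)) #
     (if even i then [F (weight (two_up (i div 2)))] else [])) [p..<q + 1])"

definition code_V :: "code_symbol list" where
  "code_V = [A 2, A 1, F 2, A 1, A 1, F 1, A 2, A 1, F 1]"

definition code_W :: "code_symbol list" where
  "code_W = [A 2, A 1, F 1, A 1, A 1, F 2, A 2, A 1, F 1]"

definition code_X :: "code_symbol list" where
  "code_X = [A 2, A 1, F 2, A 1, A 1, F 1, A 2, A 1, F 2, A 2, A 1, F 1]"

definition atom_of_code :: "code_symbol list \<Rightarrow> nat \<Rightarrow> nat \<Rightarrow> bool" where
  "atom_of_code c p q \<longleftrightarrow> is_atom p q \<and> atom_code p q = c"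

definition W_labels :: "(nat \<times> nat) set" where
  "W_labels = {(k, j). j \<le> 2 ^ (k div 2 + 1) - 2}"

definition labels_before :: "nat \<Rightarrow> nat \<Rightarrow> (nat \<times> nat) set" where
  "labels_before k j = {(k', j') \<in> W_labels. k' < k \<or> k' = k \<and> j' < j}"

(* The atom labelled W(k,j) has first term a(p) and last term a(q): in order of occurrence
   it is preceded by the very first atom of type W, labelled W(-1), and by one atom of type W
   for each label lexicographically smaller than (k,j). *)
definition W_atom :: "nat \<Rightarrow> nat \<Rightarrow> nat \<Rightarrow> nat \<Rightarrow> bool" where
  "W_atom k j p q \<longleftrightarrow> atom_of_code code_W p q \<and>
     card {p'. p' < p \<and> (\<exists>q'. atom_of_code code_W p' q')} = 1 + card (labels_before k j)"

end

theory Submission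
  imports Defs "HOL-Library.Nat_Bijection"
begin

text \<open>
  From \<open>a(49)\<close> on the sequence is described explicitly in blocks \<open>a(12 r + 1), \<dots>, a(12 r + 12)\<close>.
  The terms freed while block \<open>r\<close> is produced are \<open>a(6 r + 1), \<dots>, a(6 r + 6)\<close>, which make up half
  of block \<open>r div 2\<close>, so the description follows by induction on \<open>r\<close>. At any time at most three
  bits are free, and whether the next term is a sum of two free bits or a new power of two depends
  only on which pairs of free bits have been used before. Block \<open>r\<close> has one of two shapes,
  according to whether \<open>r + 1\<close> is a value of \<open>mu\<close>. The atoms of type \<open>W\<close> are the second halves of
  the blocks for which it is not, and \<open>W(k, j)\<close> lies in block \<open>r = \<mu>(k + 4) + j\<close>; apart from these
  blocks with \<open>r \<ge> 4\<close>, the only atom of type \<open>W\<close> is \<open>W(-1)\<close>.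
\<close>

section \<open>Free bits and the next term\<close>

text \<open>The shape of a block is hereditary. If \<open>r = 2 s\<close>, the terms freed during
  block \<open>r\<close> are the first half of block \<open>s\<close>, and for
  \<open>r \<ge> 4\<close> the odd number \<open>r + 1\<close> is no value of \<open>mu\<close>. If
  \<open>r = 2 s + 1\<close>, they are the second half of block \<open>s\<close>, and
  \<open>r + 1 = 2 (s + 1)\<close> is a value of \<open>mu\<close> exactly when \<open>s + 1\<close>
  is. So the exceptional blocks (those with \<open>r + 1\<close> a value of \<open>mu\<close>)
  descend from blocks 2 and 3 along \<open>r -> 2 r + 1\<close>. The obstacle is that the greedy
  choice depends on the whole history of used pairs. Every pair taken has a larger exponent
  exceeding all earlier ones, and so is new, with one exception: the seventh term of an exceptional
  block combines old bits. The induction starts at \<open>r = 4\<close> because then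
  \<open>r div 2 \<ge> 2\<close>, and blocks 2 and 3 belong to the table of the first 48
  terms.\<close>

lemma bit_iff_mem_set_decode: "bit x i \<longleftrightarrow> i \<in> set_decode x" for x :: nat
  by (simp add: bit_iff_odd set_decode_def)

lemma perpendicular_iff: "perpendicular x y \<longleftrightarrow> set_decode x \<inter> set_decode y = {}"
  by (auto simp: perpendicular_def bit_iff_mem_set_decode)

lemma weight_eq: "weight x = card (set_decode x)"
  by (simp add: weight_def bit_iff_mem_set_decode)

lemma set_decode_power [simp]: "set_decode (2 ^ e) = {e}"
  using set_decode_plus_power_2[of e 0] by simp

lemma set_decode_pair: "u \<noteq> v \<Longrightarrow> set_decode (2 ^ u + 2 ^ v) = {u, v}"
  by (simp add: set_decode_plus_power_2)

lemma less_power_iff_set_decode: "x < 2 ^ N \<longleftrightarrow> set_decode x \<subseteq> {..<N}"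
proof
  show "set_decode x \<subseteq> {..<N}" if "x < 2 ^ N"
  proof
    fix e assume e: "e \<in> set_decode x"
    have "2 ^ e \<le> x"
      using subset_decode_imp_le[of "2 ^ e" x] e by simp
    then show "e \<in> {..<N}"
      using that le_less_trans power_less_imp_less_exp[of 2 e N] by fastforce
  qed
  show "x < 2 ^ N" if "set_decode x \<subseteq> {..<N}"
  proof -
    have "x = (\<Sum>e \<in> set_decode x. 2 ^ e)"
      using set_decode_inverse[of x] by (simp add: set_encode_def)
    also have "\<dots> \<le> (\<Sum>e \<in> {0..<N}. 2 ^ e)"
      using that by (intro sum_mono2) auto
    also have "\<dots> < 2 ^ N"
      by (simp add: sum_power2)
    finally show ?thesis .
  qed
qed

lemma power_pair_eq_iff:
  fixes u v x y :: nat
  assumes "u < v" "x < y"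
  shows "(2::nat) ^ u + 2 ^ v = 2 ^ x + 2 ^ y \<longleftrightarrow> u = x \<and> v = y"
proof
  assume "(2::nat) ^ u + 2 ^ v = 2 ^ x + 2 ^ y"
  then have "set_decode (2 ^ u + 2 ^ v) = set_decode (2 ^ x + 2 ^ y)"
    by simp
  then have "{u, v} = {x, y}"
    using assms by (simp add: set_decode_pair)
  then show "u = x \<and> v = y"
    using assms by (auto simp: doubleton_eq_iff)
qed simp

lemma power_pair_neq_power: "u < v \<Longrightarrow> (2::nat) ^ u + 2 ^ v \<noteq> 2 ^ e"
proof
  assume "u < v" "(2::nat) ^ u + 2 ^ v = 2 ^ e"
  then have "{u, v} = {e}"
    using set_decode_pair[of u v] set_decode_power[of e] by simp
  then show False
    using \<open>u < v\<close> by auto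
qed

section \<open>The greedy choice in terms of free bits\<close>

lemma two_up_eq:
  "two_up n = (LEAST x. x \<notin> two_up ` {..<n} \<and>
     (\<forall>i \<in> {(n + 1) div 2..<n}. set_decode x \<inter> set_decode (two_up i) = {}))"
  by (subst two_up.simps) (simp only: perpendicular_iff)

text \<open>A power of two beyond all earlier terms is always a candidate, so the least candidate
  exists and has the defining property. The sum of the earlier terms serves as a crude common
  bound.\<close>

lemma two_up_disjoint:
  assumes "i \<in> {(n + 1) div 2..<n}"
  shows "set_decode (two_up n) \<inter> set_decode (two_up i) = {}"
proof -
  define B where "B = Suc (\<Sum>i<n. two_up i)"
  have less: "two_up i < 2 ^ B" if "i < n" for i
  proof -
    have "two_up i \<le> (\<Sum>i<n. two_up i)"
      using that by (intro member_le_sum) auto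
    then show ?thesis
      unfolding B_def by (meson le_imp_less_Suc less_exp less_trans)
  qed
  have "2 ^ B \<notin> two_up ` {..<n} \<and>
      (\<forall>i \<in> {(n + 1) div 2..<n}. set_decode (2 ^ B) \<inter> set_decode (two_up i) = {})"
    using less by (fastforce simp: less_power_iff_set_decode)
  then have "two_up n \<notin> two_up ` {..<n} \<and>
      (\<forall>i \<in> {(n + 1) div 2..<n}. set_decode (two_up n) \<inter> set_decode (two_up i) = {})"
    unfolding two_up_eq[of n] by (rule LeastI)
  then show ?thesis
    using assms by blast
qed

lemma two_up_0 [simp]: "two_up 0 = 0"
  by (subst two_up_eq) (simp add: Least_equality)

text \<open>The bits \<open>E\<close> are free after step \<open>n\<close>, the bits that have occurred at all are \<open>0, \<dots>, N - 1\<close>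
  (each of them also as a term \<open>2\<^sup>e\<close> of its own), and \<open>P\<close> lists the terms of weight two.\<close>

definition state :: "nat \<Rightarrow> nat set \<Rightarrow> nat \<Rightarrow> (nat \<times> nat) set \<Rightarrow> bool" where
  "state n E N P \<longleftrightarrow>
     E = {e. e < N \<and> (\<forall>i \<in> {n div 2 + 1..n}. e \<notin> set_decode (two_up i))} \<and>
     (\<forall>i \<le> n. two_up i < 2 ^ N) \<and>
     (\<forall>e < N. 2 ^ e \<in> two_up ` {..n}) \<and>
     P = {(u, v). u < v \<and> 2 ^ u + 2 ^ v \<in> two_up ` {..n}}"

definition freed :: "nat \<Rightarrow> nat set" where
  "freed n = (if even n then set_decode (two_up (n div 2)) else {})"

text \<open>A number below \<open>2 ^ N\<close> is admissible exactly when all its bits are free,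
  and \<open>2 ^ N\<close> itself is admissible and new. With \<open>x \<le> 2 ^ N\<close> the
  comparison with smaller candidates is therefore confined to the subsets of
  \<open>E\<close>.\<close>

lemma two_up_next:
  assumes st: "state n E N P"
    and x: "x \<notin> two_up ` {..n}" "x \<le> 2 ^ N" "set_decode x \<subseteq> E \<union> {N}"
    and min: "\<And>y. y < x \<Longrightarrow> set_decode y \<subseteq> E \<Longrightarrow> y \<in> two_up ` {..n}"
  shows "two_up (Suc n) = x"
proof -
  have E: "E = {e. e < N \<and> (\<forall>i \<in> {n div 2 + 1..n}. e \<notin> set_decode (two_up i))}"
    and bd0: "\<forall>i \<le> n. two_up i < 2 ^ N"
    using st unfolding state_def by blast+
  have bd: "set_decode (two_up i) \<subseteq> {..<N}" if "i \<le> n" for i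
    using that bd0 by (simp add: less_power_iff_set_decode[symmetric])
  have cand: "(\<forall>i \<in> {(Suc n + 1) div 2..<Suc n}. set_decode z \<inter> set_decode (two_up i) = {}) \<longleftrightarrow>
      set_decode z \<subseteq> E \<union> {N..}" for z
  proof -
    have "{(Suc n + 1) div 2..<Suc n} = {n div 2 + 1..n}"
      by auto
    then show ?thesis
      using bd by (force simp: E subset_iff disjoint_iff)
  qed
  show ?thesis
    unfolding two_up_eq[of "Suc n"] cand lessThan_Suc_atMost
  proof (rule Least_equality)
    show "x \<notin> two_up ` {..n} \<and> set_decode x \<subseteq> E \<union> {N..}"
      using x by auto
    fix y assume y: "y \<notin> two_up ` {..n} \<and> set_decode y \<subseteq> E \<union> {N..}"
    show "x \<le> y"
    proof (rule ccontr)
      assume "\<not> x \<le> y"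
      then have "y < x" "y < 2 ^ N"
        using x by auto
      then have "set_decode y \<subseteq> E"
        using y by (fastforce simp: less_power_iff_set_decode)
      then show False
        using min y \<open>y < x\<close> by blast
    qed
  qed
qed

text \<open>If \<open>n + 1 = 2 t\<close>, the window of recent terms loses the index
  \<open>t\<close>. Each of \<open>a(t + 1), ..., a(2 t)\<close> was chosen with \<open>t\<close> in
  its own window and so shares no bit with \<open>a(t)\<close>; hence all bits of
  \<open>a(t)\<close> become free at once.\<close>

lemma free_next:
  assumes E: "E = {e. e < N \<and> (\<forall>i \<in> {n div 2 + 1..n}. e \<notin> set_decode (two_up i))}"
    and bd: "\<forall>i \<le> n. two_up i < 2 ^ N"
  shows "E - set_decode (two_up (Suc n)) \<union> freed (Suc n) =
    {e. e < N \<and> (\<forall>i \<in> {Suc n div 2 + 1..Suc n}. e \<notin> set_decode (two_up i))}"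
proof (cases "even n")
  case True
  then have "Suc n div 2 = n div 2"
    by presburger
  then have "{Suc n div 2 + 1..Suc n} = insert (Suc n) {n div 2 + 1..n}"
    by auto
  then show ?thesis
    using True by (auto simp: E freed_def)
next
  case False
  define t where "t = Suc n div 2"
  have t: "n div 2 + 1 = t" "Suc n = 2 * t" "0 < t"
    using False by (auto simp: t_def)
  have w: "{n div 2 + 1..n} = insert t {t + 1..n}"
    using t by auto
  have w': "{Suc n div 2 + 1..Suc n} = insert (Suc n) {t + 1..n}"
    using t by auto
  have "set_decode (two_up t) \<subseteq> {..<N}"
    using bd t less_power_iff_set_decode by auto
  moreover have "set_decode (two_up i) \<inter> set_decode (two_up t) = {}"
    if "i \<in> {t + 1..Suc n}" for i
    using that t by (intro two_up_disjoint) auto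
  then have "set_decode (two_up t) \<inter> set_decode (two_up i) = {}"
    if "i \<in> {t + 1..Suc n}" for i
    using that by blast
  moreover have "insert (Suc n) {t + 1..n} = {t + 1..Suc n}"
    using t by auto
  moreover have "freed (Suc n) = set_decode (two_up t)"
    using False by (simp add: freed_def t_def)
  ultimately show ?thesis
    unfolding w' E w by blast
qed

lemma state_next_new:
  assumes st: "state n E N P"
    and used: "\<And>y. y < 2 ^ N \<Longrightarrow> set_decode y \<subseteq> E \<Longrightarrow> y \<in> two_up ` {..n}"
  shows "two_up (Suc n) = 2 ^ N \<and> state (Suc n) (E \<union> freed (Suc n)) (Suc N) P"
proof
  have E: "E = {e. e < N \<and> (\<forall>i \<in> {n div 2 + 1..n}. e \<notin> set_decode (two_up i))}"
    and bd: "\<forall>i \<le> n. two_up i < 2 ^ N"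
    and sing: "\<forall>e < N. 2 ^ e \<in> two_up ` {..n}"
    and P: "P = {(u, v). u < v \<and> 2 ^ u + 2 ^ v \<in> two_up ` {..n}}"
    using st unfolding state_def by blast+
  show new: "two_up (Suc n) = 2 ^ N"
    using bd used by (intro two_up_next[OF st]) fastforce+
  have "N \<notin> E"
    by (simp add: E)
  have N: "set_decode (two_up i) \<subseteq> {..<N}" if "i \<le> n" for i
    using bd that less_power_iff_set_decode by auto
  have bd': "\<forall>i \<le> n. two_up i < 2 ^ Suc N"
    using bd by (auto intro: less_trans)
  \<comment> \<open>The bit \<open>N\<close> has not occurred yet. Relative to the bound
    \<open>N + 1\<close> it counts as free before the step, and the new term removes it
    again.\<close>
  have "insert N E = {e. e < Suc N \<and> (\<forall>i \<in> {n div 2 + 1..n}. e \<notin> set_decode (two_up i))}"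
    using N by (fastforce simp: E less_Suc_eq)
  from free_next[OF this bd']
  have "E \<union> freed (Suc n) =
      {e. e < Suc N \<and> (\<forall>i \<in> {Suc n div 2 + 1..Suc n}. e \<notin> set_decode (two_up i))}"
    using \<open>N \<notin> E\<close> by (simp add: new insert_Diff_if Diff_insert0)
  moreover have "\<forall>i \<le> Suc n. two_up i < 2 ^ Suc N"
    using bd' by (auto simp: le_Suc_eq new)
  moreover have "\<forall>e < Suc N. 2 ^ e \<in> two_up ` {..Suc n}"
    using sing by (auto simp: atMost_Suc less_Suc_eq new)
  moreover have "P = {(u, v). u < v \<and> 2 ^ u + 2 ^ v \<in> two_up ` {..Suc n}}"
    using power_pair_neq_power by (auto simp: P atMost_Suc new)
  ultimately show "state (Suc n) (E \<union> freed (Suc n)) (Suc N) P"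
    by (simp add: state_def)
qed

lemma state_next_pair:
  assumes st: "state n E N P"
    and x: "u < v" "u \<in> E" "v \<in> E" "(u, v) \<notin> P"
    and min: "\<And>y. y < 2 ^ u + 2 ^ v \<Longrightarrow> set_decode y \<subseteq> E \<Longrightarrow> y \<in> two_up ` {..n}"
  shows "two_up (Suc n) = 2 ^ u + 2 ^ v \<and>
    state (Suc n) (E - {u, v} \<union> freed (Suc n)) N (insert (u, v) P)"
proof
  have E: "E = {e. e < N \<and> (\<forall>i \<in> {n div 2 + 1..n}. e \<notin> set_decode (two_up i))}"
    and bd: "\<forall>i \<le> n. two_up i < 2 ^ N"
    and sing: "\<forall>e < N. 2 ^ e \<in> two_up ` {..n}"
    and P: "P = {(u, v). u < v \<and> 2 ^ u + 2 ^ v \<in> two_up ` {..n}}"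
    using st unfolding state_def by blast+
  have dec: "set_decode (2 ^ u + 2 ^ v) = {u, v}"
    using x by (simp add: set_decode_pair)
  have lt: "(2::nat) ^ u + 2 ^ v < 2 ^ N"
    using x by (simp add: less_power_iff_set_decode dec E)
  show new: "two_up (Suc n) = 2 ^ u + 2 ^ v"
    using x lt dec by (intro two_up_next[OF st _ _ _ min]) (auto simp: P)
  have "E - {u, v} \<union> freed (Suc n) =
      {e. e < N \<and> (\<forall>i \<in> {Suc n div 2 + 1..Suc n}. e \<notin> set_decode (two_up i))}"
    using free_next[OF E bd] by (simp add: new dec)
  moreover have "\<forall>i \<le> Suc n. two_up i < 2 ^ N"
    using bd lt by (auto simp: le_Suc_eq new)
  moreover have "\<forall>e < N. 2 ^ e \<in> two_up ` {..Suc n}"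
    using sing by (auto simp: atMost_Suc)
  moreover have "insert (u, v) P = {(u, v). u < v \<and> 2 ^ u + 2 ^ v \<in> two_up ` {..Suc n}}"
  proof -
    have "2 ^ a + 2 ^ b \<in> two_up ` {..Suc n} \<longleftrightarrow>
        (a, b) = (u, v) \<or> 2 ^ a + 2 ^ b \<in> two_up ` {..n}" if "a < b" for a b
      using power_pair_eq_iff[OF that \<open>u < v\<close>] by (simp add: atMost_Suc new)
    then show ?thesis
      unfolding P using \<open>u < v\<close> by blast
  qed
  ultimately show "state (Suc n) (E - {u, v} \<union> freed (Suc n)) N (insert (u, v) P)"
    by (simp add: state_def)
qed

lemma state_used:
  assumes "state n E N P"
  shows "0 \<in> two_up ` {..n}"
    and "e \<in> E \<Longrightarrow> 2 ^ e \<in> two_up ` {..n}"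
    and "(u, v) \<in> P \<Longrightarrow> 2 ^ u + 2 ^ v \<in> two_up ` {..n}"
proof -
  show "0 \<in> two_up ` {..n}"
    using two_up_0 by (intro image_eqI[of _ _ 0]) auto
  show "2 ^ e \<in> two_up ` {..n}" if "e \<in> E"
    using assms that unfolding state_def by blast
  show "2 ^ u + 2 ^ v \<in> two_up ` {..n}" if "(u, v) \<in> P"
    using assms that unfolding state_def by blast
qed

lemma set_decode_eqD: "set_decode y = S \<Longrightarrow> y = set_encode S"
  by auto

lemma set_decode_subset3:
  assumes "set_decode y \<subseteq> {u, v, w}" "u < v" "v < w"
  shows "y \<in> {0, 2 ^ u, 2 ^ v, 2 ^ w, 2 ^ u + 2 ^ v, 2 ^ u + 2 ^ w, 2 ^ v + 2 ^ w,
    2 ^ u + (2 ^ v + 2 ^ w)}"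
proof -
  from assms have "set_decode y = {} \<or> set_decode y = {u} \<or> set_decode y = {v} \<or>
      set_decode y = {w} \<or> set_decode y = {u, v} \<or> set_decode y = {u, w} \<or>
      set_decode y = {v, w} \<or> set_decode y = {u, v, w}"
    by blast
  then show ?thesis
    using assms by (auto dest!: set_decode_eqD)
qed

lemma set_decode_subset2:
  assumes "set_decode y \<subseteq> {u, v}" "u < v"
  shows "y \<in> {0, 2 ^ u, 2 ^ v, 2 ^ u + 2 ^ v}"
proof -
  from assms have "set_decode y = {} \<or> set_decode y = {u} \<or> set_decode y = {v} \<or>
      set_decode y = {u, v}"
    by blast
  then show ?thesis
    using assms by (auto dest!: set_decode_eqD)
qed

section \<open>The next term when at most three bits are free\<close>

lemma next_new1:
  assumes st: "state n E N P" and E: "E \<subseteq> {e}" and m: "m = Suc n"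
  shows "two_up m = 2 ^ N \<and> state m (E \<union> freed m) (Suc N) P"
  unfolding m
proof (rule state_next_new[OF st])
  fix y assume "set_decode y \<subseteq> E"
  then have "set_decode y = {} \<or> e \<in> E \<and> set_decode y = {e}"
    using E by blast
  then show "y \<in> two_up ` {..n}"
    using state_used[OF st] by (auto dest!: set_decode_eqD)
qed

lemma next_new2:
  assumes st: "state n {u, v} N P" and uv: "u < v" "(u, v) \<in> P" and m: "m = Suc n"
  shows "two_up m = 2 ^ N \<and> state m ({u, v} \<union> freed m) (Suc N) P"
  unfolding m
proof (rule state_next_new[OF st])
  fix y assume "set_decode y \<subseteq> {u, v}"
  from set_decode_subset2[OF this \<open>u < v\<close>]
  show "y \<in> two_up ` {..n}"
    using state_used[OF st] uv by auto
qed

lemma next_pair: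
  assumes st: "state n {u, v} N P" and uv: "u < v" "(u, v) \<notin> P" and m: "m = Suc n"
  shows "two_up m = 2 ^ u + 2 ^ v \<and> state m (freed m) N (insert (u, v) P)"
proof -
  have "y \<in> two_up ` {..n}" if "y < 2 ^ u + 2 ^ v" "set_decode y \<subseteq> {u, v}" for y
    using set_decode_subset2[OF that(2) uv(1)] that(1) state_used[OF st] by auto
  from state_next_pair[OF st uv(1) _ _ uv(2) this] show ?thesis
    by (simp add: m)
qed

lemma next_triple:
  assumes st: "state n {u, v, w} N P" and uvw: "u < v" "v < w" and m: "m = Suc n"
  shows next_triple_uv: "(u, v) \<notin> P \<Longrightarrow>
      two_up m = 2 ^ u + 2 ^ v \<and> state m ({w} \<union> freed m) N (insert (u, v) P)"
    and next_triple_uw: "(u, v) \<in> P \<Longrightarrow> (u, w) \<notin> P \<Longrightarrow>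
      two_up m = 2 ^ u + 2 ^ w \<and> state m ({v} \<union> freed m) N (insert (u, w) P)"
    and next_triple_vw: "(u, v) \<in> P \<Longrightarrow> (u, w) \<in> P \<Longrightarrow> (v, w) \<notin> P \<Longrightarrow>
      two_up m = 2 ^ v + 2 ^ w \<and> state m ({u} \<union> freed m) N (insert (v, w) P)"
proof -
  have less: "(2::nat) ^ u < 2 ^ v" "(2::nat) ^ v < 2 ^ w"
    using uvw by simp_all
  have diff: "{u, v, w} - {u, v} = {w}" "{u, v, w} - {u, w} = {v}" "{u, v, w} - {v, w} = {u}"
    using uvw by auto
  have "(2::nat) ^ u + 2 ^ v < 2 ^ w"
    using uvw set_decode_pair[of u v] by (subst less_power_iff_set_decode) auto
  note less = less this
  note used = state_used[OF st]
  show "two_up m = 2 ^ u + 2 ^ v \<and> state m ({w} \<union> freed m) N (insert (u, v) P)"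
    if "(u, v) \<notin> P"
  proof -
    have "y \<in> two_up ` {..n}" if y: "y < 2 ^ u + 2 ^ v" "set_decode y \<subseteq> {u, v, w}" for y
      using set_decode_subset3[OF y(2) uvw] y(1) used less by auto
    from state_next_pair[OF st _ _ _ that this] show ?thesis
      using uvw by (simp add: m diff)
  qed
  show "two_up m = 2 ^ u + 2 ^ w \<and> state m ({v} \<union> freed m) N (insert (u, w) P)"
    if "(u, v) \<in> P" "(u, w) \<notin> P"
  proof -
    have "y \<in> two_up ` {..n}" if y: "y < 2 ^ u + 2 ^ w" "set_decode y \<subseteq> {u, v, w}" for y
      using set_decode_subset3[OF y(2) uvw] y(1) used less that \<open>(u, v) \<in> P\<close> by auto
    from state_next_pair[OF st _ _ _ that(2) this] show ?thesis
      using uvw by (simp add: m diff)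
  qed
  show "two_up m = 2 ^ v + 2 ^ w \<and> state m ({u} \<union> freed m) N (insert (v, w) P)"
    if "(u, v) \<in> P" "(u, w) \<in> P" "(v, w) \<notin> P"
  proof -
    have "y \<in> two_up ` {..n}" if y: "y < 2 ^ v + 2 ^ w" "set_decode y \<subseteq> {u, v, w}" for y
      using set_decode_subset3[OF y(2) uvw] y(1) used less \<open>(u, v) \<in> P\<close> \<open>(u, w) \<in> P\<close> by auto
    from state_next_pair[OF st _ _ _ that(3) this] show ?thesis
      using uvw by (simp add: m diff)
  qed
qed

lemma state_imp_atom_end_iff:
  assumes st: "state n E N P" and n: "0 < n"
  shows "atom_end n \<longleftrightarrow> (\<exists>u v. u < v \<and> E = {u, v} \<and> (u, v) \<notin> P)"
proof -
  have E: "E = {e. e < N \<and> (\<forall>i \<in> {n div 2 + 1..n}. e \<notin> set_decode (two_up i))}"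
    and bd0: "\<forall>i \<le> n. two_up i < 2 ^ N"
    and sing: "\<And>e. e < N \<Longrightarrow> 2 ^ e \<in> two_up ` {..n}"
    and P: "P = {(u, v). u < v \<and> 2 ^ u + 2 ^ v \<in> two_up ` {..n}}"
    using st unfolding state_def by blast+
  have bd: "set_decode (two_up i) \<subseteq> {..<N}" if "i \<le> n" for i
    using that bd0 by (simp add: less_power_iff_set_decode[symmetric])
  \<comment> \<open>\<open>state\<close> counts the term \<open>a(0) = 0\<close> and
    \<open>atom_end\<close> does not. A sum of two powers is nonzero, so both give the same
    verdict.\<close>
  have "{..n} = insert 0 {1..n}"
    by auto
  then have img: "two_up ` {..n} = insert 0 (two_up ` {1..n})"
    by simp
  have seen: "(\<exists>i \<in> {1..n}. e \<in> set_decode (two_up i)) \<longleftrightarrow> e < N" for e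
  proof
    assume "e < N"
    then have "2 ^ e \<in> two_up ` {1..n}"
      using sing[of e] img by auto
    then obtain i where "i \<in> {1..n}" "two_up i = 2 ^ e"
      by auto
    then show "\<exists>i \<in> {1..n}. e \<in> set_decode (two_up i)"
      by (auto intro!: bexI[of _ i])
  qed (use bd in fastforce)
  have free: "free_powers n = (^) 2 ` E"
    unfolding free_powers_def bit_iff_mem_set_decode seen E by auto
  have inj: "inj ((^) (2::nat))"
    by (simp add: inj_on_def)
  have "finite E"
    by (simp add: E)
  have "card (free_powers n) = card E" "\<Sum>(free_powers n) = set_encode E"
    using inj \<open>finite E\<close>
    by (simp_all add: free card_image inj_on_def sum.reindex set_encode_def)
  then have ae: "atom_end n \<longleftrightarrow> card E = 2 \<and> set_encode E \<notin> two_up ` {1..n}"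
    using n by (simp add: atom_end_def)
  have "card E = 2 \<longleftrightarrow> (\<exists>u v. u < v \<and> E = {u, v})"
  proof
    assume "card E = 2"
    then obtain u v where "E = {u, v}" "u \<noteq> v"
      by (auto simp: card_2_iff)
    then show "\<exists>u v. u < v \<and> E = {u, v}"
      by (metis insert_commute nat_neq_iff)
  qed auto
  moreover have "set_encode {u, v} \<notin> two_up ` {1..n} \<longleftrightarrow> (u, v) \<notin> P" if "u < v" for u v
    using that img by (auto simp: P)
  ultimately show ?thesis
    unfolding ae by blast
qed

lemma not_atom_end:
  assumes "state n E N P" "0 < n"
  shows not_atom_end_card: "card E \<noteq> 2 \<Longrightarrow> \<not> atom_end n"
    and not_atom_end_used: "E = {u, v} \<Longrightarrow> u < v \<Longrightarrow> (u, v) \<in> P \<Longrightarrow> \<not> atom_end n"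
    and atom_end_pair: "E = {u, v} \<Longrightarrow> u < v \<Longrightarrow> (u, v) \<notin> P \<Longrightarrow> atom_end n"
  using state_imp_atom_end_iff[OF assms] by (auto simp: doubleton_eq_iff)

section \<open>The first 48 terms\<close>

text \<open>The highest differing exponent outweighs all lower ones together. With this criterion
  the table can be checked on lists of exponents, without computing the powers.\<close>

lemma set_encode_less:
  assumes fin: "finite S" "finite T" and e: "e \<in> S - T" "\<And>f. f \<in> T - S \<Longrightarrow> f < e"
  shows "set_encode T < set_encode S"
proof -
  have un: "set_encode (A \<union> B) = set_encode A + set_encode B"
    if "finite A" "finite B" "A \<inter> B = {}" for A B
    using that by (simp add: set_encode_def sum.union_disjoint)
  have "set_encode (T - S) < 2 ^ e"
    using fin e by (auto simp: less_power_iff_set_decode)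
  also have "2 ^ e \<le> set_encode (S - T)"
    using fin e by (intro subset_decode_imp_le) auto
  finally have "set_encode (T - S) + set_encode (T \<inter> S) < set_encode (S - T) + set_encode (T \<inter> S)"
    by simp
  moreover have "(T - S) \<union> (T \<inter> S) = T" "(S - T) \<union> (T \<inter> S) = S"
    "(T - S) \<inter> (T \<inter> S) = {}" "(S - T) \<inter> (T \<inter> S) = {}"
    by auto
  ultimately show ?thesis
    using un[of "T - S" "T \<inter> S"] un[of "S - T" "T \<inter> S"] fin by simp
qed

text \<open>Each term is given by the list of the exponents in its binary expansion.\<close>

definition initial_terms :: "nat list list" where
  "initial_terms =
   [[], [0], [1], [2], [3], [0,1], [4], [5], [6], [2,3], [7], [8], [9], [0,4], [10],
    [1,5], [11], [12], [13], [2,6], [14], [3,7], [15], [16], [17], [8,9], [18],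
    [19], [20], [0,10], [21], [1,4], [22], [5,11], [23], [24], [25], [12,13], [26],
    [27], [28], [2,14], [29], [3,6], [30], [7,15], [31], [32], [33]]"

text \<open>Executable counterparts of the components \<open>N\<close>, \<open>E\<close> and
  \<open>P\<close> of \<open>state\<close>. Counting singleton lists yields \<open>N\<close> because
  the powers of two appear in the table in increasing order without gaps.\<close>

definition initial_N :: "nat \<Rightarrow> nat" where
  "initial_N n = length (filter (\<lambda>es. length es = 1) (take (Suc n) initial_terms))"

definition initial_E :: "nat \<Rightarrow> nat list" where
  "initial_E n = filter (\<lambda>e. \<forall>es \<in> set (drop (n div 2 + 1) (take (Suc n) initial_terms)). e \<notin> set es) [0..<initial_N n]"

definition initial_P :: "nat \<Rightarrow> (nat \<times> nat) list" where
  "initial_P n = map (\<lambda>es. (es ! 0, es ! 1)) (filter (\<lambda>es. length es = 2) (take (Suc n) initial_terms))"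

definition initial_consistent :: "nat \<Rightarrow> bool" where
  "initial_consistent n \<longleftrightarrow>
     (\<forall>es \<in> set (take (Suc n) initial_terms). length es \<le> 2 \<and> sorted_wrt (<) es \<and> (\<forall>e \<in> set es. e < initial_N n)) \<and>
     (\<forall>e \<in> set [0..<initial_N n]. [e] \<in> set (take (Suc n) initial_terms))"

text \<open>A certificate for one greedy step. Each subset of the free bits must be used already, be
  the entry itself, or exceed it by the criterion of the highest differing exponent; if the entry is
  a new power, all subsets must be used.\<close>

definition initial_next :: "nat \<Rightarrow> bool" where
  "initial_next n \<longleftrightarrow>
     (let t = initial_terms ! Suc n; used = take (Suc n) initial_terms; E = initial_E n; N = initial_N n in
       t \<notin> set used \<and> (t = [N] \<or> t \<in> set (subseqs E)) \<and>
       (\<forall>s \<in> set (subseqs E). s \<in> set used \<or>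
          (if t = [N] then False
           else s = t \<or> (\<exists>e \<in> set s. e \<notin> set t \<and> (\<forall>f \<in> set t. f \<in> set s \<or> f < e)))))"

lemma initial_consistent_all: "list_all initial_consistent [0..<49]"
  by code_simp

lemma initial_next_all: "list_all initial_next [0..<48]"
  by code_simp


lemma length_initial_terms: "length initial_terms = 49"
  by (simp add: initial_terms_def)

lemma initial_consistent: "n \<le> 48 \<Longrightarrow> initial_consistent n"
  using initial_consistent_all by (auto simp: list_all_iff)

lemma initial_state:
  assumes n: "n \<le> 48" and val: "\<And>i. i \<le> n \<Longrightarrow> two_up i = set_encode (set (initial_terms ! i))"
  shows "state n (set (initial_E n)) (initial_N n) (set (initial_P n))"
proof -
  define L where "L = take (Suc n) initial_terms"
  have L_nth: "L ! i = initial_terms ! i" if "i \<le> n" for i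
    using that by (simp add: L_def)
  have length_L: "length L = Suc n"
    using n by (simp add: L_def length_initial_terms)
  have set_L: "set L = (!) initial_terms ` {..n}"
    using L_nth by (force simp: set_conv_nth length_L less_Suc_eq_le)
  have con: "\<And>es. es \<in> set L \<Longrightarrow> length es \<le> 2 \<and> sorted_wrt (<) es \<and> (\<forall>e \<in> set es. e < initial_N n)"
    "\<And>e. e < initial_N n \<Longrightarrow> [e] \<in> set L"
    using initial_consistent[OF n] by (auto simp: initial_consistent_def L_def)
  have dec: "set_decode (two_up i) = set (initial_terms ! i)" if "i \<le> n" for i
    using val[OF that] by simp
  have "set (drop (n div 2 + 1) L) = (!) initial_terms ` {n div 2 + 1..n}"
  proof -
    have "x \<in> set (drop (n div 2 + 1) L) \<longleftrightarrow> x \<in> (!) initial_terms ` {n div 2 + 1..n}" for x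
    proof
      assume "x \<in> set (drop (n div 2 + 1) L)"
      then obtain i where "i < n - n div 2" "x = L ! (n div 2 + 1 + i)"
        by (auto simp: in_set_conv_nth length_L)
      then show "x \<in> (!) initial_terms ` {n div 2 + 1..n}"
        using L_nth[of "n div 2 + 1 + i"] by (intro image_eqI[of _ _ "n div 2 + 1 + i"]) auto
    next
      assume "x \<in> (!) initial_terms ` {n div 2 + 1..n}"
      then obtain i where i: "n div 2 + 1 \<le> i" "i \<le> n" "x = initial_terms ! i"
        by auto
      then have "x = drop (n div 2 + 1) L ! (i - (n div 2 + 1))"
        using L_nth by (simp add: length_L)
      then show "x \<in> set (drop (n div 2 + 1) L)"
        using i by (auto simp: in_set_conv_nth length_L intro!: exI[of _ "i - (n div 2 + 1)"])
    qed
    then show ?thesis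
      by blast
  qed
  then have "set (initial_E n) =
      {e. e < initial_N n \<and> (\<forall>i \<in> {n div 2 + 1..n}. e \<notin> set_decode (two_up i))}"
    using dec by (auto simp: initial_E_def L_def[symmetric])
  moreover have "\<forall>i \<le> n. two_up i < 2 ^ initial_N n"
    using con(1) set_L by (auto simp: less_power_iff_set_decode dec)
  moreover have "\<forall>e < initial_N n. 2 ^ e \<in> two_up ` {..n}"
  proof (intro allI impI)
    fix e assume "e < initial_N n"
    then obtain i where "i \<le> n" "initial_terms ! i = [e]"
      using con(2) set_L by force
    then show "2 ^ e \<in> two_up ` {..n}"
      using val[of i] by (intro image_eqI[of _ _ i]) auto
  qed
  moreover have "(u, v) \<in> set (initial_P n) \<longleftrightarrow> u < v \<and> 2 ^ u + 2 ^ v \<in> two_up ` {..n}" for u v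
  proof
    assume "(u, v) \<in> set (initial_P n)"
    then obtain es where es: "es \<in> set L" "length es = 2" "u = es ! 0" "v = es ! 1"
      by (auto simp: initial_P_def L_def)
    then have "es = [u, v]"
      by (auto simp: numeral_2_eq_2 length_Suc_conv)
    moreover obtain i where "i \<le> n" "initial_terms ! i = es"
      using es(1) set_L by auto
    ultimately show "u < v \<and> 2 ^ u + 2 ^ v \<in> two_up ` {..n}"
      using val[of i] con(1)[OF es(1)] by (auto intro!: image_eqI[of _ _ i])
  next
    assume uv: "u < v \<and> 2 ^ u + 2 ^ v \<in> two_up ` {..n}"
    then obtain i where i: "i \<le> n" "2 ^ u + 2 ^ v = two_up i"
      by auto
    then have eq: "set (initial_terms ! i) = {u, v}"
      using dec[of i] set_decode_pair[of u v] uv by auto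
    have mem: "initial_terms ! i \<in> set L"
      using i set_L by auto
    have sorted: "sorted_wrt (<) (initial_terms ! i)" "sorted_wrt (<) [u, v]"
      using con(1)[OF mem] uv by auto
    have "initial_terms ! i = [u, v]"
      using strict_sorted_equal[OF sorted] eq by simp
    then show "(u, v) \<in> set (initial_P n)"
      using mem by (force simp: initial_P_def L_def)
  qed
  then have "set (initial_P n) = {(u, v). u < v \<and> 2 ^ u + 2 ^ v \<in> two_up ` {..n}}"
    by blast
  ultimately show ?thesis
    unfolding state_def by blast
qed

lemma initial_step:
  assumes n: "n < 48" and val: "\<And>i. i \<le> n \<Longrightarrow> two_up i = set_encode (set (initial_terms ! i))"
  shows "two_up (Suc n) = set_encode (set (initial_terms ! Suc n))"
proof -
  define t where "t = initial_terms ! Suc n"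
  define N where "N = initial_N n"
  define L where "L = take (Suc n) initial_terms"
  have st: "state n (set (initial_E n)) N (set (initial_P n))"
    using initial_state[of n] n val by (simp add: N_def)
  have length_L: "length L = Suc n"
    using n by (simp add: L_def length_initial_terms)
  have set_L: "set L = (!) initial_terms ` {..n}"
    using n by (auto simp: L_def nth_image[symmetric] length_initial_terms lessThan_Suc_atMost atLeast0LessThan)
  have sorted: "sorted_wrt (<) (initial_terms ! i)" if "i \<le> Suc n" for i
  proof -
    have "initial_terms ! i \<in> set (take (Suc (Suc n)) initial_terms)"
      using that n by (auto simp: in_set_conv_nth length_initial_terms intro!: exI[of _ i])
    then show ?thesis
      using initial_consistent[of "Suc n"] n by (simp add: initial_consistent_def)
  qed
  have nx: "initial_next n"
    using initial_next_all n by (simp add: list_all_iff)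
  have t: "t \<notin> set L" "t = [N] \<or> t \<in> set (subseqs (initial_E n))"
    "\<And>s. s \<in> set (subseqs (initial_E n)) \<Longrightarrow> s \<notin> set L \<Longrightarrow>
       t \<noteq> [N] \<and> (s = t \<or> (\<exists>e \<in> set s. e \<notin> set t \<and> (\<forall>f \<in> set t. f \<in> set s \<or> f < e)))"
    using nx by (auto simp: initial_next_def Let_def t_def L_def N_def split: if_splits)
  have sub: "set s \<subseteq> set (initial_E n)" if "s \<in> set (subseqs (initial_E n))" for s
    using that subseqs_powset[of "initial_E n"] by auto
  have less_N: "set (initial_E n) \<subseteq> {..<N}"
    by (auto simp: initial_E_def N_def)
  show ?thesis
    unfolding t_def[symmetric]
  proof (rule two_up_next[OF st])
    show "set_encode (set t) \<notin> two_up ` {..n}"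
    proof
      assume "set_encode (set t) \<in> two_up ` {..n}"
      then obtain i where i: "i \<le> n" "set_encode (set t) = set_encode (set (initial_terms ! i))"
        using val by auto
      then have "t = initial_terms ! i"
        using sorted[of i] sorted[of "Suc n"]
        by (intro strict_sorted_equal) (auto simp: set_encode_eq t_def)
      then show False
        using t(1) i set_L by auto
    qed
    show "set_encode (set t) \<le> 2 ^ N"
    proof (cases "t = [N]")
      case False
      then have "set_decode (set_encode (set t)) \<subseteq> {..<N}"
        using t(2) sub less_N by auto
      then show ?thesis
        using less_power_iff_set_decode less_imp_le by blast
    qed simp
    show "set_decode (set_encode (set t)) \<subseteq> set (initial_E n) \<union> {N}"
      using t(2) sub by auto
    fix y assume y: "y < set_encode (set t)" "set_decode y \<subseteq> set (initial_E n)"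
    \<comment> \<open>\<open>subseqs\<close> runs through the whole powerset, so an arbitrary
      smaller candidate is one of the lists that \<open>initial_next\<close> has tested.\<close>
    obtain s where s: "s \<in> set (subseqs (initial_E n))" "set s = set_decode y"
      using y(2) subseqs_powset[of "initial_E n"] by (metis Pow_iff imageE)
    have y_eq: "y = set_encode (set s)"
      by (simp add: s(2))
    show "y \<in> two_up ` {..n}"
    proof (cases "s \<in> set L")
      case True
      then show ?thesis
        using val set_L by (auto simp: y_eq)
    next
      case False
      from t(3)[OF s(1) this] have "set_encode (set t) \<le> set_encode (set s)"
      proof (elim conjE disjE bexE)
        fix e assume "e \<in> set s" "e \<notin> set t" "\<forall>f \<in> set t. f \<in> set s \<or> f < e"
        then have "set_encode (set t) < set_encode (set s)"
          by (intro set_encode_less[of _ _ e]) auto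
        then show ?thesis
          by simp
      qed simp
      then show ?thesis
        using y(1) y_eq by simp
    qed
  qed
qed

lemma two_up_initial_terms: "n \<le> 48 \<Longrightarrow> two_up n = set_encode (set (initial_terms ! n))"
proof (induction n rule: less_induct)
  case (less n)
  show ?case
  proof (cases n)
    case 0
    then show ?thesis
      by (simp add: initial_terms_def)
  next
    case (Suc m)
    then show ?thesis
      using initial_step[of m] less by simp
  qed
qed

lemma state_initial_terms: "n \<le> 48 \<Longrightarrow> state n (set (initial_E n)) (initial_N n) (set (initial_P n))"
  using initial_state two_up_initial_terms by simp

definition initial_atom_end :: "nat \<Rightarrow> bool" where
  "initial_atom_end n \<longleftrightarrow> (case initial_E n of [u, v] \<Rightarrow> (u, v) \<notin> set (initial_P n) | _ \<Rightarrow> False)"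

lemma atom_end_initial_terms:
  assumes "0 < n" "n \<le> 48"
  shows "atom_end n \<longleftrightarrow> initial_atom_end n"
proof -
  have sorted: "sorted_wrt (<) (initial_E n)"
    unfolding initial_E_def by (intro sorted_wrt_filter) simp
  have "(\<exists>u v. u < v \<and> set (initial_E n) = {u, v} \<and> (u, v) \<notin> set (initial_P n)) \<longleftrightarrow>
      (\<exists>u v. initial_E n = [u, v] \<and> (u, v) \<notin> set (initial_P n))"
  proof (intro ex_cong1)
    fix u v
    have "u < v \<and> set (initial_E n) = {u, v} \<longleftrightarrow> initial_E n = [u, v]"
      using strict_sorted_equal[OF sorted, of "[u, v]"] sorted by auto
    then show "u < v \<and> set (initial_E n) = {u, v} \<and> (u, v) \<notin> set (initial_P n) \<longleftrightarrow>
        initial_E n = [u, v] \<and> (u, v) \<notin> set (initial_P n)"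
      by blast
  qed
  also have "\<dots> \<longleftrightarrow> initial_atom_end n"
    by (auto simp: initial_atom_end_def split: list.splits)
  finally show ?thesis
    using state_imp_atom_end_iff[OF state_initial_terms[OF assms(2)] assms(1)] by simp
qed

lemma initial_atom_end_all:
  "filter initial_atom_end [1..<49] = [4, 8, 14, 20, 24, 32, 36, 44, 48]"
  by code_simp

lemma atom_end_initial:
  assumes "0 < n" "n \<le> 48"
  shows "atom_end n \<longleftrightarrow> n \<in> {4, 8, 14, 20, 24, 32, 36, 44, 48}"
proof -
  have "atom_end n \<longleftrightarrow> n \<in> set (filter initial_atom_end [1..<49])"
    using atom_end_initial_terms[OF assms] assms by auto
  then show ?thesis
    unfolding initial_atom_end_all by simp
qed

lemma state_48:
  "state 48 {16, 17} 34 {(0,1),(2,3),(0,4),(1,5),(2,6),(3,7),(8,9),(0,10),(1,4),(5,11),(12,13),(2,14),(3,6),(7,15)}"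
proof -
  have "initial_E 48 = [16, 17]" "initial_N 48 = 34"
    "initial_P 48 = [(0,1),(2,3),(0,4),(1,5),(2,6),(3,7),(8,9),(0,10),(1,4),(5,11),(12,13),(2,14),(3,6),(7,15)]"
    by code_simp+
  then show ?thesis
    using state_initial_terms[of 48] by simp
qed

section \<open>Blocks of twelve terms\<close>

definition mu_values :: "nat set" where
  "mu_values = {2 ^ i | i. True} \<union> {3 * 2 ^ i | i. True}"

lemma mu_values_iff: "x \<in> mu_values \<longleftrightarrow> (\<exists>i. x = 2 ^ i \<or> x = 3 * 2 ^ i)"
  by (auto simp: mu_values_def)

lemma double_mu_values_iff [simp]: "2 * x \<in> mu_values \<longleftrightarrow> x \<in> mu_values"
proof
  assume "2 * x \<in> mu_values"
  then obtain i where i: "2 * x = 2 ^ i \<or> 2 * x = 3 * 2 ^ i"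
    by (auto simp: mu_values_iff)
  \<comment> \<open>Otherwise the even number \<open>2 * x\<close> would be 1 or 3.\<close>
  then have "i \<noteq> 0"
    by (intro notI) (auto, presburger+)
  then show "x \<in> mu_values"
    using i by (cases i) (auto simp: mu_values_iff)
next
  assume "x \<in> mu_values"
  then obtain i where "x = 2 ^ i \<or> x = 3 * 2 ^ i"
    by (auto simp: mu_values_iff)
  then have "2 * x = 2 ^ Suc i \<or> 2 * x = 3 * 2 ^ Suc i"
    by auto
  then show "2 * x \<in> mu_values"
    unfolding mu_values_iff by blast
qed

lemma odd_mu_values: "x \<in> mu_values \<Longrightarrow> odd x \<Longrightarrow> x = 1 \<or> x = 3"
  by (auto simp: mu_values_iff)

text \<open>Applied to \<open>x = r + 1\<close>: an exceptional \<open>r \<ge> 4\<close> other than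
  5 is 3 modulo 4, so \<open>r -> 2 r + 1\<close> can be undone twice.\<close>

lemma mu_values_mod_4:
  assumes "x \<in> mu_values" "5 \<le> x"
  shows "x = 6 \<or> 4 dvd x"
proof -
  obtain y where y: "x = 2 * y"
    using odd_mu_values assms by fastforce
  then have "y \<in> mu_values" "3 \<le> y"
    using assms by auto
  then show ?thesis
    using odd_mu_values[of y] y by (auto elim: evenE)
qed

text \<open>If \<open>r + 1\<close> is a value of \<open>mu\<close>, three bits are free after step \<open>12 r + 6\<close>: the term
  \<open>a(12 r + 7)\<close> uses \<open>mid_lo r\<close> and \<open>mid_hi r\<close> and leaves \<open>mid_rest r\<close> for \<open>a(12 r + 9)\<close>.
  Which pair is the smallest unused one settles into a pattern only from \<open>r = 23\<close> on; the
  smaller \<open>r\<close> concerned are \<open>2, 3, 5, 7, 11, 15\<close>.\<close>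

definition mid_lo :: "nat \<Rightarrow> nat" where
  "mid_lo r = (if r = 2 then 1 else if r = 5 then 4 else if r = 7 then 6
     else if r = 11 then 5 else if r = 15 then 7 else r)"

definition mid_hi :: "nat \<Rightarrow> nat" where
  "mid_hi r = (if r = 2 then 4 else if r = 3 then 6 else if r = 5 then 5 else if r = 7 then 7
     else 2 * r + 1)"

text \<open>The leftover bit is handed down along \<open>r -> 2 r + 1\<close>: it is 11 on the line
  \<open>r + 1 = 3 * 2 ^ i\<close> from \<open>r = 5\<close> on, and 15 on the line
  \<open>r + 1 = 2 ^ i\<close> from \<open>r = 7\<close> on. Divisibility of \<open>r + 1\<close> by
  3 tells the two lines apart.\<close>

definition mid_rest :: "nat \<Rightarrow> nat" where
  "mid_rest r = (if r = 2 then 5 else if r = 3 then 7 else if 3 dvd r + 1 then 11 else 15)"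

text \<open>The \<open>if\<close> in the first term reflects which two bits the preceding block
  leaves behind. The smaller exponents at \<open>12 r + 5\<close> and \<open>12 r + 11\<close> are
  inherited by halving the index and stay existential; \<open>z\<close> ties
  \<open>12 r + 11\<close> to \<open>6 r + 5\<close>, just as \<open>y\<close> ties
  \<open>a(n + 4)\<close> to \<open>a(m)\<close> in the theorem.\<close>

definition block_values :: "nat \<Rightarrow> bool" where
  "block_values r \<longleftrightarrow>
     two_up (12 * r + 1) = 2 ^ (if r \<in> mu_values then 4 * r else 2 * r) + 2 ^ (4 * r + 1) \<and>
     two_up (12 * r + 2) = 2 ^ (8 * r + 2) \<and>
     two_up (12 * r + 3) = 2 ^ (8 * r + 3) \<and>
     two_up (12 * r + 4) = 2 ^ (8 * r + 4) \<and>
     (\<exists>u < 4 * r + 2. two_up (12 * r + 5) = 2 ^ u + 2 ^ (4 * r + 2)) \<and>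
     two_up (12 * r + 6) = 2 ^ (8 * r + 5) \<and>
     two_up (12 * r + 8) = 2 ^ (8 * r + 6) \<and>
     two_up (12 * r + 12) = 2 ^ (8 * r + 9) \<and>
     (if r + 1 \<in> mu_values then
        two_up (12 * r + 7) = 2 ^ mid_lo r + 2 ^ mid_hi r \<and>
        two_up (12 * r + 9) = 2 ^ mid_rest r + 2 ^ (4 * r + 3) \<and>
        two_up (12 * r + 10) = 2 ^ (8 * r + 7) \<and>
        two_up (12 * r + 11) = 2 ^ (8 * r + 8)
      else
        two_up (12 * r + 7) = 2 ^ (2 * r + 1) + 2 ^ (4 * r + 3) \<and>
        two_up (12 * r + 9) = 2 ^ (8 * r + 7) \<and>
        two_up (12 * r + 10) = 2 ^ (8 * r + 8) \<and>
        (\<exists>z < 2 * r + 2. two_up (6 * r + 5) = 2 ^ z + 2 ^ (2 * r + 2) \<and>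
           two_up (12 * r + 11) = 2 ^ z + 2 ^ (4 * r + 4)))"

definition block_ends :: "nat \<Rightarrow> bool" where
  "block_ends r \<longleftrightarrow> (\<forall>i \<in> {1..12}.
     atom_end (12 * r + i) \<longleftrightarrow> i = 12 \<or> i = (if r + 1 \<in> mu_values then 8 else 6))"

lemma state_pairI:
  "state n E N P \<Longrightarrow> i \<le> n \<Longrightarrow> u < v \<Longrightarrow> two_up i = 2 ^ u + 2 ^ v \<Longrightarrow> (u, v) \<in> P"
  unfolding state_def by (auto intro!: image_eqI[of _ _ i])

lemma freed_block:
  "freed (12 * r + 1) = {}" "freed (12 * r + 3) = {}" "freed (12 * r + 5) = {}"
  "freed (12 * r + 7) = {}" "freed (12 * r + 9) = {}" "freed (12 * r + 11) = {}"
  "freed (12 * r + 2) = set_decode (two_up (6 * r + 1))"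
  "freed (12 * r + 4) = set_decode (two_up (6 * r + 2))"
  "freed (12 * r + 6) = set_decode (two_up (6 * r + 3))"
  "freed (12 * r + 8) = set_decode (two_up (6 * r + 4))"
  "freed (12 * r + 10) = set_decode (two_up (6 * r + 5))"
  "freed (12 * r + 12) = set_decode (two_up (6 * r + 6))"
proof -
  have "(12 * r + 2 * k) div 2 = 6 * r + k" for k
    by simp
  from this[of 1] this[of 2] this[of 3] this[of 4] this[of 5] this[of 6]
  show "freed (12 * r + 2) = set_decode (two_up (6 * r + 1))"
    "freed (12 * r + 4) = set_decode (two_up (6 * r + 2))"
    "freed (12 * r + 6) = set_decode (two_up (6 * r + 3))"
    "freed (12 * r + 8) = set_decode (two_up (6 * r + 4))"
    "freed (12 * r + 10) = set_decode (two_up (6 * r + 5))"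
    "freed (12 * r + 12) = set_decode (two_up (6 * r + 6))"
    unfolding freed_def by simp_all
qed (simp_all add: freed_def)

text \<open>The bits \<open>u\<close> and \<open>v\<close> freed by \<open>a(6 r + 1)\<close> form a
  used pair, namely that very term, and stay idle until \<open>4 r + 2\<close> joins them. The pairs
  taken contain \<open>4 r + 1\<close> and \<open>4 r + 2\<close>, which exceed all larger exponents
  used before.\<close>

lemma block_first_half:
  assumes st: "state (12 * r) {l, 4 * r + 1} (8 * r + 2) P" and l: "l < 4 * r + 1"
    and P: "snd ` P \<subseteq> {..4 * r}"
    and a1: "two_up (6 * r + 1) = 2 ^ u + 2 ^ v" and uv: "u < v" "v < 4 * r + 2" and "1 \<le> r"
    and a2: "two_up (6 * r + 2) = 2 ^ (4 * r + 2)"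
  shows "two_up (12 * r + 1) = 2 ^ l + 2 ^ (4 * r + 1) \<and>
     two_up (12 * r + 2) = 2 ^ (8 * r + 2) \<and>
     two_up (12 * r + 3) = 2 ^ (8 * r + 3) \<and>
     two_up (12 * r + 4) = 2 ^ (8 * r + 4) \<and>
     two_up (12 * r + 5) = 2 ^ u + 2 ^ (4 * r + 2) \<and>
     two_up (12 * r + 6) = 2 ^ (8 * r + 5) \<and>
     state (12 * r + 6) (insert v (set_decode (two_up (6 * r + 3)))) (8 * r + 6)
       (insert (u, 4 * r + 2) (insert (l, 4 * r + 1) P)) \<and>
     \<not> atom_end (12 * r + 1) \<and> \<not> atom_end (12 * r + 2) \<and> \<not> atom_end (12 * r + 3) \<and>
     \<not> atom_end (12 * r + 4) \<and> \<not> atom_end (12 * r + 5)"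
proof -
  have bd: "b \<le> 4 * r" if "(a, b) \<in> P" for a b
    using P that by force
  define P1 where "P1 = insert (l, 4 * r + 1) P"
  define P2 where "P2 = insert (u, 4 * r + 2) P1"
  have dec1: "set_decode (two_up (6 * r + 1)) = {u, v}"
    unfolding a1 using uv by (intro set_decode_pair) auto
  have dec2: "set_decode (two_up (6 * r + 2)) = {4 * r + 2}"
    unfolding a2 by (rule set_decode_power)
  have "(u, v) \<in> P"
    using uv a1 \<open>1 \<le> r\<close> by (intro state_pairI[OF st, of "6 * r + 1"]) auto
  then have uvP: "(u, v) \<in> P1"
    by (simp add: P1_def)
  have bd1: "b \<le> 4 * r + 1" if "(a, b) \<in> P1" for a b
    using that bd[of a b] by (auto simp: P1_def)
  have "(l, 4 * r + 1) \<notin> P"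
    using bd[of l "4 * r + 1"] by auto
  with next_pair[OF st, of "12 * r + 1"] l
  have v1: "two_up (12 * r + 1) = 2 ^ l + 2 ^ (4 * r + 1)"
    and s1: "state (12 * r + 1) {} (8 * r + 2) P1"
    unfolding freed_block P1_def by auto
  from next_new1[OF s1, of _ "12 * r + 2"]
  have v2: "two_up (12 * r + 2) = 2 ^ (8 * r + 2)"
    and s2: "state (12 * r + 2) {u, v} (8 * r + 3) P1"
    unfolding freed_block dec1 by (auto simp: eval_nat_numeral)
  from next_new2[OF s2, of "12 * r + 3"] uv uvP
  have v3: "two_up (12 * r + 3) = 2 ^ (8 * r + 3)"
    and s3: "state (12 * r + 3) {u, v} (8 * r + 4) P1"
    unfolding freed_block by (auto simp: eval_nat_numeral)
  have set3: "{u, v} \<union> {4 * r + 2} = {u, v, 4 * r + 2}"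
    by auto
  from next_new2[OF s3, of "12 * r + 4"] uv uvP
  have v4: "two_up (12 * r + 4) = 2 ^ (8 * r + 4)"
    and s4: "state (12 * r + 4) {u, v, 4 * r + 2} (8 * r + 5) P1"
    unfolding freed_block dec2 set3 by (auto simp: eval_nat_numeral)
  have "(u, 4 * r + 2) \<notin> P1"
    using bd1[of u "4 * r + 2"] by auto
  from next_triple_uw[OF s4 _ _ _ uvP this, of "12 * r + 5"] uv
  have v5: "two_up (12 * r + 5) = 2 ^ u + 2 ^ (4 * r + 2)"
    and s5: "state (12 * r + 5) {v} (8 * r + 5) P2"
    unfolding freed_block P2_def by auto
  from next_new1[OF s5, of v "12 * r + 6"]
  have v6: "two_up (12 * r + 6) = 2 ^ (8 * r + 5)"
    and s6: "state (12 * r + 6) (insert v (set_decode (two_up (6 * r + 3)))) (8 * r + 6) P2"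
    unfolding freed_block by (auto simp: eval_nat_numeral)
  have "\<not> atom_end (12 * r + 1)"
    by (rule not_atom_end_card[OF s1]) auto
  moreover have "\<not> atom_end (12 * r + 2)"
    by (rule not_atom_end_used[OF s2 _ refl uv(1) uvP]) auto
  moreover have "\<not> atom_end (12 * r + 3)"
    by (rule not_atom_end_used[OF s3 _ refl uv(1) uvP]) auto
  moreover have "\<not> atom_end (12 * r + 4)"
    using uv by (intro not_atom_end_card[OF s4]) auto
  moreover have "\<not> atom_end (12 * r + 5)"
    by (rule not_atom_end_card[OF s5]) auto
  ultimately show ?thesis
    using v1 v2 v3 v4 v5 v6 s6 by (simp add: P1_def P2_def)
qed

text \<open>Again the exponents \<open>4 r + 3\<close>, \<open>4 r + 4\<close> and finally
  \<open>4 r + 5\<close> rise above all earlier ones. The bits left, \<open>2 (r + 1)\<close> and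
  \<open>4 (r + 1) + 1\<close>, open a block whose index is no value of \<open>mu\<close>.\<close>

lemma block_second_half_regular:
  assumes st: "state (12 * r + 6) {2 * r + 1, 4 * r + 3} (8 * r + 6) P"
    and P: "snd ` P \<subseteq> {..4 * r + 2}"
    and a4: "two_up (6 * r + 4) = 2 ^ (4 * r + 4)"
    and a5: "two_up (6 * r + 5) = 2 ^ z + 2 ^ (2 * r + 2)" and z: "z < 2 * r + 2"
    and a6: "two_up (6 * r + 6) = 2 ^ (4 * r + 5)"
  shows "two_up (12 * r + 7) = 2 ^ (2 * r + 1) + 2 ^ (4 * r + 3) \<and>
     two_up (12 * r + 8) = 2 ^ (8 * r + 6) \<and>
     two_up (12 * r + 9) = 2 ^ (8 * r + 7) \<and>
     two_up (12 * r + 10) = 2 ^ (8 * r + 8) \<and>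
     two_up (12 * r + 11) = 2 ^ z + 2 ^ (4 * r + 4) \<and>
     two_up (12 * r + 12) = 2 ^ (8 * r + 9) \<and>
     state (12 * r + 12) {2 * r + 2, 4 * r + 5} (8 * r + 10)
       (insert (z, 4 * r + 4) (insert (2 * r + 1, 4 * r + 3) P)) \<and>
     atom_end (12 * r + 6) \<and> \<not> atom_end (12 * r + 7) \<and> \<not> atom_end (12 * r + 8) \<and>
     \<not> atom_end (12 * r + 9) \<and> \<not> atom_end (12 * r + 10) \<and> \<not> atom_end (12 * r + 11) \<and>
     atom_end (12 * r + 12)"
proof -
  have bd: "b \<le> 4 * r + 2" if "(a, b) \<in> P" for a b
    using P that by force
  define P1 where "P1 = insert (2 * r + 1, 4 * r + 3) P"
  define P2 where "P2 = insert (z, 4 * r + 4) P1"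
  have dec4: "set_decode (two_up (6 * r + 4)) = {4 * r + 4}"
    unfolding a4 by (rule set_decode_power)
  have dec5: "set_decode (two_up (6 * r + 5)) = {z, 2 * r + 2}"
    unfolding a5 using z by (intro set_decode_pair) auto
  have dec6: "set_decode (two_up (6 * r + 6)) = {4 * r + 5}"
    unfolding a6 by (rule set_decode_power)
  have bd1: "b \<le> 4 * r + 3" if "(a, b) \<in> P1" for a b
    using that bd[of a b] by (auto simp: P1_def)
  have bd2: "b \<le> 4 * r + 4" if "(a, b) \<in> P2" for a b
    using that bd1[of a b] by (auto simp: P2_def)
  have new: "(2 * r + 1, 4 * r + 3) \<notin> P"
    using bd[of "2 * r + 1" "4 * r + 3"] by auto
  with next_pair[OF st, of "12 * r + 7"]
  have v7: "two_up (12 * r + 7) = 2 ^ (2 * r + 1) + 2 ^ (4 * r + 3)"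
    and s7: "state (12 * r + 7) {} (8 * r + 6) P1"
    unfolding freed_block P1_def by auto
  from next_new1[OF s7, of _ "12 * r + 8"]
  have v8: "two_up (12 * r + 8) = 2 ^ (8 * r + 6)"
    and s8: "state (12 * r + 8) {4 * r + 4} (8 * r + 7) P1"
    unfolding freed_block dec4 by (auto simp: eval_nat_numeral)
  from next_new1[OF s8, of "4 * r + 4" "12 * r + 9"]
  have v9: "two_up (12 * r + 9) = 2 ^ (8 * r + 7)"
    and s9: "state (12 * r + 9) {4 * r + 4} (8 * r + 8) P1"
    unfolding freed_block by (auto simp: eval_nat_numeral)
  have set10: "{4 * r + 4} \<union> {z, 2 * r + 2} = {z, 2 * r + 2, 4 * r + 4}"
    by auto
  from next_new1[OF s9, of "4 * r + 4" "12 * r + 10"]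
  have v10: "two_up (12 * r + 10) = 2 ^ (8 * r + 8)"
    and s10: "state (12 * r + 10) {z, 2 * r + 2, 4 * r + 4} (8 * r + 9) P1"
    unfolding freed_block dec5 set10 by (auto simp: eval_nat_numeral)
  \<comment> \<open>\<open>z\<close> and \<open>2 r + 2\<close> were freed by one term, so their
    pair is used and the next smallest pair \<open>(z, 4 r + 4)\<close> is taken.\<close>
  have "(z, 2 * r + 2) \<in> P1"
    using z a5 by (intro state_pairI[OF s10, of "6 * r + 5"]) auto
  moreover have "(z, 4 * r + 4) \<notin> P1"
    using bd1[of z "4 * r + 4"] by auto
  ultimately have v11: "two_up (12 * r + 11) = 2 ^ z + 2 ^ (4 * r + 4)"
    and s11: "state (12 * r + 11) {2 * r + 2} (8 * r + 9) P2"
    using next_triple_uw[OF s10, of "12 * r + 11"] z unfolding freed_block P2_def by auto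
  have set12: "{2 * r + 2} \<union> {4 * r + 5} = {2 * r + 2, 4 * r + 5}"
    by auto
  from next_new1[OF s11, of "2 * r + 2" "12 * r + 12"]
  have v12: "two_up (12 * r + 12) = 2 ^ (8 * r + 9)"
    and s12: "state (12 * r + 12) {2 * r + 2, 4 * r + 5} (8 * r + 10) P2"
    unfolding freed_block dec6 set12 by (auto simp: eval_nat_numeral)
  have "(2 * r + 2, 4 * r + 5) \<notin> P2"
    using bd2[of "2 * r + 2" "4 * r + 5"] by auto
  then have "atom_end (12 * r + 12)"
    by (intro atom_end_pair[OF s12 _ refl]) auto
  moreover have "atom_end (12 * r + 6)"
    using new by (intro atom_end_pair[OF st _ refl]) auto
  moreover have "\<not> atom_end (12 * r + 7)"
    by (rule not_atom_end_card[OF s7]) auto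
  moreover have "\<not> atom_end (12 * r + 8)"
    by (rule not_atom_end_card[OF s8]) auto
  moreover have "\<not> atom_end (12 * r + 9)"
    by (rule not_atom_end_card[OF s9]) auto
  moreover have "\<not> atom_end (12 * r + 10)"
    using z by (intro not_atom_end_card[OF s10]) auto
  moreover have "\<not> atom_end (12 * r + 11)"
    by (rule not_atom_end_card[OF s11]) auto
  ultimately show ?thesis
    using v7 v8 v9 v10 v11 v12 s12 by (simp add: P1_def P2_def)
qed

text \<open>\<open>c\<close> is the bit left by the term at \<open>12 r + 7\<close>; it waits for
  the freed bit \<open>4 r + 3\<close>. The bits left at the end, \<open>4 (r + 1)\<close> and
  \<open>4 (r + 1) + 1\<close>, open a block whose index is a value of \<open>mu\<close>.\<close>

lemma block_second_half_exceptional: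
  assumes st: "state (12 * r + 7) {c} (8 * r + 6) P" and c: "c < 4 * r + 3"
    and P: "snd ` P \<subseteq> {..4 * r + 2}"
    and a4: "two_up (6 * r + 4) = 2 ^ (4 * r + 3)"
    and a5: "two_up (6 * r + 5) = 2 ^ (4 * r + 4)"
    and a6: "two_up (6 * r + 6) = 2 ^ (4 * r + 5)"
  shows "two_up (12 * r + 8) = 2 ^ (8 * r + 6) \<and>
     two_up (12 * r + 9) = 2 ^ c + 2 ^ (4 * r + 3) \<and>
     two_up (12 * r + 10) = 2 ^ (8 * r + 7) \<and>
     two_up (12 * r + 11) = 2 ^ (8 * r + 8) \<and>
     two_up (12 * r + 12) = 2 ^ (8 * r + 9) \<and>
     state (12 * r + 12) {4 * r + 4, 4 * r + 5} (8 * r + 10) (insert (c, 4 * r + 3) P) \<and>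
     \<not> atom_end (12 * r + 7) \<and> atom_end (12 * r + 8) \<and> \<not> atom_end (12 * r + 9) \<and>
     \<not> atom_end (12 * r + 10) \<and> \<not> atom_end (12 * r + 11) \<and> atom_end (12 * r + 12)"
proof -
  have bd: "b \<le> 4 * r + 2" if "(a, b) \<in> P" for a b
    using P that by force
  define P1 where "P1 = insert (c, 4 * r + 3) P"
  have dec4: "set_decode (two_up (6 * r + 4)) = {4 * r + 3}"
    unfolding a4 by (rule set_decode_power)
  have dec5: "set_decode (two_up (6 * r + 5)) = {4 * r + 4}"
    unfolding a5 by (rule set_decode_power)
  have dec6: "set_decode (two_up (6 * r + 6)) = {4 * r + 5}"
    unfolding a6 by (rule set_decode_power)
  have bd1: "b \<le> 4 * r + 3" if "(a, b) \<in> P1" for a b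
    using that bd[of a b] by (auto simp: P1_def)
  have set8: "{c} \<union> {4 * r + 3} = {c, 4 * r + 3}"
    by auto
  from next_new1[OF st, of c "12 * r + 8"]
  have v8: "two_up (12 * r + 8) = 2 ^ (8 * r + 6)"
    and s8: "state (12 * r + 8) {c, 4 * r + 3} (8 * r + 7) P"
    unfolding freed_block dec4 set8 by (auto simp: eval_nat_numeral)
  have new: "(c, 4 * r + 3) \<notin> P"
    using bd[of c "4 * r + 3"] by auto
  with next_pair[OF s8, of "12 * r + 9"] c
  have v9: "two_up (12 * r + 9) = 2 ^ c + 2 ^ (4 * r + 3)"
    and s9: "state (12 * r + 9) {} (8 * r + 7) P1"
    unfolding freed_block P1_def by auto
  from next_new1[OF s9, of _ "12 * r + 10"]
  have v10: "two_up (12 * r + 10) = 2 ^ (8 * r + 7)"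
    and s10: "state (12 * r + 10) {4 * r + 4} (8 * r + 8) P1"
    unfolding freed_block dec5 by (auto simp: eval_nat_numeral)
  from next_new1[OF s10, of "4 * r + 4" "12 * r + 11"]
  have v11: "two_up (12 * r + 11) = 2 ^ (8 * r + 8)"
    and s11: "state (12 * r + 11) {4 * r + 4} (8 * r + 9) P1"
    unfolding freed_block by (auto simp: eval_nat_numeral)
  have set12: "{4 * r + 4} \<union> {4 * r + 5} = {4 * r + 4, 4 * r + 5}"
    by auto
  from next_new1[OF s11, of "4 * r + 4" "12 * r + 12"]
  have v12: "two_up (12 * r + 12) = 2 ^ (8 * r + 9)"
    and s12: "state (12 * r + 12) {4 * r + 4, 4 * r + 5} (8 * r + 10) P1"
    unfolding freed_block dec6 set12 by (auto simp: eval_nat_numeral)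
  have "(4 * r + 4, 4 * r + 5) \<notin> P1"
    using bd1[of "4 * r + 4" "4 * r + 5"] by auto
  then have "atom_end (12 * r + 12)"
    by (intro atom_end_pair[OF s12 _ refl]) auto
  moreover have "\<not> atom_end (12 * r + 7)"
    by (rule not_atom_end_card[OF st]) auto
  moreover have "atom_end (12 * r + 8)"
    using new c by (intro atom_end_pair[OF s8 _ refl]) auto
  moreover have "\<not> atom_end (12 * r + 9)"
    by (rule not_atom_end_card[OF s9]) auto
  moreover have "\<not> atom_end (12 * r + 10)"
    by (rule not_atom_end_card[OF s10]) auto
  moreover have "\<not> atom_end (12 * r + 11)"
    by (rule not_atom_end_card[OF s11]) auto
  ultimately show ?thesis
    using v8 v9 v10 v11 v12 s12 by (simp add: P1_def)
qed

section \<open>The induction over the blocks\<close>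

text \<open>The regular value \<open>v = 2 r + 1\<close> has two sources: \<open>4 s + 1\<close>
  from the first term of block \<open>s\<close> if \<open>r = 2 s\<close>, and
  \<open>4 s + 3\<close> from its seventh term if \<open>r = 2 s + 1\<close>. The exceptional case
  arises only from the seventh term.\<close>

lemma half_block_values:
  assumes r: "4 \<le> r" and bv: "block_values (r div 2)"
  shows "(\<exists>u v. two_up (6 * r + 1) = 2 ^ u + 2 ^ v \<and> u < v \<and> v < 4 * r + 2 \<and>
       v = (if r + 1 \<in> mu_values then mid_hi (r div 2) else 2 * r + 1)) \<and>
     two_up (6 * r + 2) = 2 ^ (4 * r + 2) \<and>
     (if r + 1 \<in> mu_values then
        two_up (6 * r + 3) = 2 ^ mid_rest (r div 2) + 2 ^ (2 * r + 1) \<and>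
        two_up (6 * r + 4) = 2 ^ (4 * r + 3) \<and>
        two_up (6 * r + 5) = 2 ^ (4 * r + 4)
      else
        two_up (6 * r + 3) = 2 ^ (4 * r + 3) \<and>
        two_up (6 * r + 4) = 2 ^ (4 * r + 4) \<and>
        (\<exists>z < 2 * r + 2. two_up (6 * r + 5) = 2 ^ z + 2 ^ (2 * r + 2))) \<and>
     two_up (6 * r + 6) = 2 ^ (4 * r + 5)"
proof (cases "even r")
  case True
  then obtain s where s: "r = 2 * s"
    by (elim evenE)
  have nM: "r + 1 \<notin> mu_values"
    using odd_mu_values[of "r + 1"] True r by auto
  have idx: "6 * r = 12 * s" "4 * r = 8 * s" "2 * r = 4 * s" "r div 2 = s"
    using s by simp_all
  have "(if s \<in> mu_values then 4 * s else 2 * s) < 4 * s + 1"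
    by simp
  moreover have "4 * s + 1 < 8 * s + 2"
    by simp
  ultimately show ?thesis
    using bv nM unfolding block_values_def idx by (simp only: if_False) blast
next
  case False
  then obtain s where s: "r = 2 * s + 1"
    by (elim oddE)
  have M: "r + 1 \<in> mu_values \<longleftrightarrow> s + 1 \<in> mu_values"
    using double_mu_values_iff[of "s + 1"] by (simp add: s)
  have idx: "6 * r + 1 = 12 * s + 7" "6 * r + 2 = 12 * s + 8" "6 * r + 3 = 12 * s + 9"
    "6 * r + 4 = 12 * s + 10" "6 * r + 5 = 12 * s + 11" "6 * r + 6 = 12 * s + 12"
    "4 * r + 2 = 8 * s + 6" "4 * r + 3 = 8 * s + 7" "4 * r + 4 = 8 * s + 8" "4 * r + 5 = 8 * s + 9"
    "2 * r + 1 = 4 * s + 3" "2 * r + 2 = 4 * s + 4" "r div 2 = s"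
    using s by simp_all
  have "2 \<le> s"
    using r s by simp
  then have mid: "mid_lo s < mid_hi s" "mid_hi s < 8 * s + 6"
    by (auto simp: mid_lo_def mid_hi_def)
  have reg: "2 * s + 1 < 4 * s + 3" "4 * s + 3 < 8 * s + 6"
    by simp_all
  have z: "\<exists>z < 4 * s + 4. two_up (12 * s + 11) = 2 ^ z + 2 ^ (4 * s + 4)"
    if "\<exists>z < 2 * s + 2. two_up (6 * s + 5) = 2 ^ z + 2 ^ (2 * s + 2) \<and>
      two_up (12 * s + 11) = 2 ^ z + 2 ^ (4 * s + 4)"
  proof -
    from that obtain z where "z < 2 * s + 2" "two_up (12 * s + 11) = 2 ^ z + 2 ^ (4 * s + 4)"
      by blast
    then show ?thesis
      by (intro exI[of _ z]) auto
  qed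
  show ?thesis
  proof (cases "s + 1 \<in> mu_values")
    case True
    then show ?thesis
      using bv mid unfolding block_values_def M idx by (simp only: if_True) blast
  next
    case False
    then show ?thesis
      using bv reg z unfolding block_values_def M idx by (simp only: if_False) blast
  qed
qed

text \<open>Two generations are undone because the choice in block \<open>4 t + 3\<close> depends on
  pairs used in block \<open>t\<close> as well as in block \<open>2 t + 1\<close>.\<close>

lemma exceptional_cases:
  assumes "4 \<le> r" "r + 1 \<in> mu_values"
  shows "r = 5 \<or> r = 7 \<or> (\<exists>t. t + 1 \<in> mu_values \<and> r = 4 * t + 3 \<and> 2 \<le> t)"
proof (cases "r + 1 = 6 \<or> r + 1 = 8")
  case False
  then have "4 dvd r + 1"
    using mu_values_mod_4[of "r + 1"] assms by auto
  then obtain q where q: "r + 1 = 4 * q"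
    by (elim dvdE)
  have "2 * q \<in> mu_values"
    using double_mu_values_iff[of "2 * q"] assms(2) unfolding q by simp
  then have "q \<in> mu_values"
    by simp
  moreover have "3 \<le> q"
    using q False assms(1) by auto
  ultimately have "q - 1 + 1 \<in> mu_values" "r = 4 * (q - 1) + 3" "2 \<le> q - 1"
    using q by auto
  then show ?thesis
    by blast
qed auto

text \<open>The residue separates the reserved pairs from those that a block adds with larger
  exponent \<open>4 r + 1\<close>, \<open>4 r + 2\<close> or \<open>4 r + 4\<close>. Only
  \<open>4 r + 3\<close> calls for another argument.\<close>

lemma mid_hi_eqD:
  assumes "4 \<le> q" "q + 1 \<in> mu_values"
  shows "mid_hi q = 5 \<or> mid_hi q mod 4 = 3"
  using exceptional_cases[OF assms]
proof (elim disjE exE conjE)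
  fix t assume "q = 4 * t + 3" "2 \<le> t"
  then have "mid_hi q = 4 * (2 * t + 1) + 3"
    by (simp add: mid_hi_def)
  then show ?thesis
    by (simp only: mod_mult_self4) simp
qed (auto simp: mid_hi_def)

text \<open>The last conjunct says that the pairs which \<open>exceptional_middle\<close> is going to use are still
  available; the bound on \<open>P\<close> makes all other pairs used in block \<open>r\<close> new.\<close>

definition block_invariant :: "nat \<Rightarrow> (nat \<times> nat) set \<Rightarrow> bool" where
  "block_invariant r P \<longleftrightarrow>
     state (12 * r) {if r \<in> mu_values then 4 * r else 2 * r, 4 * r + 1} (8 * r + 2) P \<and>
     snd ` P \<subseteq> {..4 * r} \<and>
     (\<forall>q \<ge> r. q + 1 \<in> mu_values \<longrightarrow> (mid_lo q, mid_hi q) \<notin> P)"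

lemma exceptional_middle:
  assumes r: "4 \<le> r" "r + 1 \<in> mu_values"
    and bv: "\<forall>s \<in> {2..<r}. block_values s"
    and a3: "two_up (6 * r + 3) = 2 ^ mid_rest (r div 2) + 2 ^ (2 * r + 1)"
    and st: "state (12 * r + 6) {mid_hi (r div 2), mid_rest (r div 2), 2 * r + 1} N P"
    and new: "(mid_lo r, mid_hi r) \<notin> P"
  shows "two_up (12 * r + 7) = 2 ^ mid_lo r + 2 ^ mid_hi r \<and>
     state (12 * r + 7) {mid_rest r} N (insert (mid_lo r, mid_hi r) P) \<and>
     \<not> atom_end (12 * r + 6)"
proof -
  consider "r = 5" | "r = 7" | "r = 11" | "r = 15" |
    t where "t + 1 \<in> mu_values" "r = 4 * t + 3" "5 \<le> t"
  proof -
    \<comment> \<open>This rules out \<open>t = 4\<close>, that is, \<open>r = 19\<close>;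
      \<open>t = 2\<close> and \<open>t = 3\<close> give \<open>r = 11\<close> and
      \<open>r = 15\<close>.\<close>
    have "5 \<notin> mu_values"
      using odd_mu_values[of 5] by auto
    then have "t \<noteq> 4" if "t + 1 \<in> mu_values" for t
      using that by auto
    moreover have "t = 2 \<or> t = 3 \<or> t = 4 \<or> 5 \<le> t" if "2 \<le> t" for t :: nat
      using that by auto
    ultimately show ?thesis
      using exceptional_cases[OF r] that by fastforce
  qed
  then show ?thesis
  proof cases
    case 1
    then show ?thesis
      using next_triple_uv[OF st, of 67] not_atom_end_card[OF st] new freed_block(4)[of r]
      by (auto simp: mid_lo_def mid_hi_def mid_rest_def)
  next
    case 2
    then show ?thesis
      using next_triple_uv[OF st, of 91] not_atom_end_card[OF st] new freed_block(4)[of r]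
      by (auto simp: mid_lo_def mid_hi_def mid_rest_def)
  next
    case 3
    have "3 \<in> mu_values"
      unfolding mu_values_iff by (intro exI[of _ 0]) simp
    then have "two_up 33 = 2 ^ 5 + 2 ^ 11"
      using bv[rule_format, of 2] 3 by (simp add: block_values_def mid_rest_def)
    then have "(5, 11) \<in> P"
      using 3 by (intro state_pairI[OF st, of 33]) auto
    then show ?thesis
      using 3 next_triple_uw[OF st, of 139] not_atom_end_card[OF st] new freed_block(4)[of r]
      by (auto simp: mid_lo_def mid_hi_def mid_rest_def)
  next
    case 4
    have "4 \<in> mu_values"
      unfolding mu_values_iff by (intro exI[of _ 2]) simp
    then have "two_up 45 = 2 ^ 7 + 2 ^ 15"
      using bv[rule_format, of 3] 4 by (simp add: block_values_def mid_rest_def)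
    then have "(7, 15) \<in> P"
      using 4 by (intro state_pairI[OF st, of 45]) auto
    then show ?thesis
      using 4 next_triple_uw[OF st, of 187] not_atom_end_card[OF st] new freed_block(4)[of r]
      by (auto simp: mid_lo_def mid_hi_def mid_rest_def)
  next
    case (5 t)
    define c where "c = mid_rest r"
    have s: "r div 2 = 2 * t + 1"
      using 5 by simp
    \<comment> \<open>Doubling does not affect divisibility by 3, so the three generations
      \<open>t\<close>, \<open>2 t + 1\<close> and \<open>r\<close> leave the same bit
      \<open>c\<close>.\<close>
    have "3 dvd t + 1 \<longleftrightarrow> 3 dvd r + 1" "3 dvd t + 1 \<longleftrightarrow> 3 dvd 2 * t + 1 + 1"
      unfolding 5 by presburger+
    then have rest: "mid_rest (r div 2) = c" "mid_rest t = c"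
      using 5 unfolding s by (auto simp: mid_rest_def c_def)
    have hi: "mid_hi (r div 2) = r" "mid_lo r = r" "mid_hi r = 2 * r + 1"
      using 5 unfolding s by (auto simp: mid_hi_def mid_lo_def)
    have c: "c < r"
      using 5 by (auto simp: c_def mid_rest_def)
    have "two_up (12 * t + 9) = 2 ^ c + 2 ^ r"
      using bv[rule_format, of t] 5 rest by (simp add: block_values_def)
    then have cr: "(c, r) \<in> P"
      using c 5 by (intro state_pairI[OF st, of "12 * t + 9"]) auto
    have "two_up (6 * r + 3) = 2 ^ c + 2 ^ (2 * r + 1)"
      using a3 rest by simp
    then have c2r: "(c, 2 * r + 1) \<in> P"
      using c by (intro state_pairI[OF st, of "6 * r + 3"]) auto
    have set: "{mid_hi (r div 2), mid_rest (r div 2), 2 * r + 1} = {c, r, 2 * r + 1}"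
      using rest hi by auto
    note st' = st[unfolded set]
    have "\<not> atom_end (12 * r + 6)"
      using c by (intro not_atom_end_card[OF st']) auto
    moreover have "two_up (12 * r + 7) = 2 ^ r + 2 ^ (2 * r + 1) \<and>
        state (12 * r + 7) ({c} \<union> freed (12 * r + 7)) N (insert (r, 2 * r + 1) P)"
      using c cr c2r new unfolding hi by (intro next_triple_vw[OF st']) auto
    ultimately show ?thesis
      unfolding hi freed_block c_def[symmetric] by simp
  qed
qed

text \<open>The values of all earlier blocks are assumed, rather than those of block
  \<open>r div 2\<close> alone, because an exceptional middle looks two generations back.\<close>

lemma block_step:
  assumes r: "4 \<le> r" and bv: "\<forall>s \<in> {2..<r}. block_values s"
    and inv: "block_invariant r P"
  shows "block_values r \<and> block_ends r \<and> (\<exists>P'. block_invariant (r + 1) P')"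
proof -
  define l where "l = (if r \<in> mu_values then 4 * r else 2 * r)"
  have l: "l < 4 * r + 1"
    by (simp add: l_def)
  have st: "state (12 * r) {l, 4 * r + 1} (8 * r + 2) P"
    and P: "snd ` P \<subseteq> {..4 * r}"
    and mid: "\<And>q. r \<le> q \<Longrightarrow> q + 1 \<in> mu_values \<Longrightarrow> (mid_lo q, mid_hi q) \<notin> P"
    using inv unfolding block_invariant_def l_def by blast+
  have half: "block_values (r div 2)"
    using r bv by simp
  note hv = half_block_values[OF r half]
  obtain u v where a1: "two_up (6 * r + 1) = 2 ^ u + 2 ^ v" and uv: "u < v" "v < 4 * r + 2"
    and v: "v = (if r + 1 \<in> mu_values then mid_hi (r div 2) else 2 * r + 1)"
    using hv by blast
  have a2: "two_up (6 * r + 2) = 2 ^ (4 * r + 2)" and a6: "two_up (6 * r + 6) = 2 ^ (4 * r + 5)"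
    using hv by blast+
  have "1 \<le> r"
    using r by simp
  note first = block_first_half[OF st l P a1 uv \<open>1 \<le> r\<close> a2]
  have value5: "\<exists>u < 4 * r + 2. two_up (12 * r + 5) = 2 ^ u + 2 ^ (4 * r + 2)"
    using first less_trans[OF uv] by blast
  define P1 where "P1 = insert (u, 4 * r + 2) (insert (l, 4 * r + 1) P)"
  have st6: "state (12 * r + 6) (insert v (set_decode (two_up (6 * r + 3)))) (8 * r + 6) P1"
    using first unfolding P1_def by blast
  have P1: "snd ` P1 \<subseteq> {..4 * r + 2}"
    using P by (auto simp: P1_def)
  have mid1: "(mid_lo q, mid_hi q) \<notin> P1" if q: "r \<le> q" "q + 1 \<in> mu_values" for q
  proof -
    have "mid_hi q = 5 \<or> mid_hi q mod 4 = 3"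
      using mid_hi_eqD q r by auto
    then have "mid_hi q \<noteq> 4 * r + 1" "mid_hi q \<noteq> 4 * r + 2"
      using r by (auto simp: mod_simps) presburger+
    then show ?thesis
      using mid[OF q] by (simp add: P1_def)
  qed
  have ends: "block_ends r" if "\<And>i. i \<in> {1,2,3,4,5,6,7,8,9,10,11,12} \<Longrightarrow>
      atom_end (12 * r + i) \<longleftrightarrow> i = 12 \<or> i = (if r + 1 \<in> mu_values then 8 else 6)"
  proof -
    have "i \<in> {1,2,3,4,5,6,7,8,9,10,11,12}" if "i \<in> {1..12}" for i :: nat
      using that by simp presburger
    then show ?thesis
      unfolding block_ends_def using that by blast
  qed
  have idx: "12 * (r + 1) = 12 * r + 12" "4 * (r + 1) = 4 * r + 4" "4 * r + 4 + 1 = 4 * r + 5"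
    "2 * (r + 1) = 2 * r + 2" "8 * (r + 1) + 2 = 8 * r + 10"
    by simp_all
  show ?thesis
  proof (cases "r + 1 \<in> mu_values")
    case False
    then have a3: "two_up (6 * r + 3) = 2 ^ (4 * r + 3)"
      and a4: "two_up (6 * r + 4) = 2 ^ (4 * r + 4)"
      using hv by simp_all
    obtain z where z: "z < 2 * r + 2" and a5: "two_up (6 * r + 5) = 2 ^ z + 2 ^ (2 * r + 2)"
      using hv False by auto
    have "state (12 * r + 6) {2 * r + 1, 4 * r + 3} (8 * r + 6) P1"
      using st6 False by (simp only: v a3 set_decode_power if_False)
    note second = block_second_half_regular[OF this P1 a4 a5 z a6]
    define P2 where "P2 = insert (z, 4 * r + 4) (insert (2 * r + 1, 4 * r + 3) P1)"
    have "\<exists>z < 2 * r + 2. two_up (6 * r + 5) = 2 ^ z + 2 ^ (2 * r + 2) \<and>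
        two_up (12 * r + 11) = 2 ^ z + 2 ^ (4 * r + 4)"
      using second z a5 by blast
    then have "block_values r"
      unfolding block_values_def l_def[symmetric] if_not_P[OF False]
      using first second value5 by blast
    moreover have "block_ends r"
      using first second False by (intro ends) auto
    moreover have "block_invariant (r + 1) P2"
    proof -
      have "state (12 * r + 12) {2 * r + 2, 4 * r + 5} (8 * r + 10) P2"
        using second unfolding P2_def by blast
      moreover have "snd ` P2 \<subseteq> {..4 * r + 4}"
        using P1 by (fastforce simp: P2_def)
      moreover have "(mid_lo q, mid_hi q) \<notin> P2" if q: "r + 1 \<le> q" "q + 1 \<in> mu_values" for q
      proof -
        have "mid_hi q = 5 \<or> mid_hi q mod 4 = 3"
          using mid_hi_eqD q r by auto
        then have "mid_hi q \<noteq> 4 * r + 4"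
          using r by (auto simp: mod_simps)
        \<comment> \<open>Equality would force \<open>q = 2 r + 1\<close>, and then
          \<open>q + 1 = 2 (r + 1)\<close> would make block \<open>r\<close> exceptional.\<close>
        moreover have "mid_hi q \<noteq> 4 * r + 3"
        proof
          assume "mid_hi q = 4 * r + 3"
          then have "q = 2 * r + 1"
            using r q by (auto simp: mid_hi_def split: if_splits)
          then have "2 * (r + 1) \<in> mu_values"
            using q by simp
          then show False
            using False by (simp only: double_mu_values_iff)
        qed
        ultimately show ?thesis
          using mid1[of q] q by (simp add: P2_def)
      qed
      ultimately show ?thesis
        unfolding block_invariant_def idx if_not_P[OF False] by blast
    qed
    ultimately show ?thesis
      by blast
  next
    case True
    then have a3: "two_up (6 * r + 3) = 2 ^ mid_rest (r div 2) + 2 ^ (2 * r + 1)"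
      and a4: "two_up (6 * r + 4) = 2 ^ (4 * r + 3)"
      and a5: "two_up (6 * r + 5) = 2 ^ (4 * r + 4)"
      using hv by simp_all
    have "odd r"
      using odd_mu_values[OF True] r by auto
    have "mid_rest (r div 2) \<noteq> 2 * r + 1"
      using r by (auto simp: mid_rest_def)
    then have "state (12 * r + 6) {mid_hi (r div 2), mid_rest (r div 2), 2 * r + 1} (8 * r + 6) P1"
      using st6 True set_decode_pair[of "mid_rest (r div 2)" "2 * r + 1"]
      by (simp only: v a3 if_True simp_thms)
    note middle = exceptional_middle[OF r True bv a3 this mid1[OF order_refl True]]
    define P2 where "P2 = insert (mid_lo r, mid_hi r) P1"
    have st7: "state (12 * r + 7) {mid_rest r} (8 * r + 6) P2"
      using middle unfolding P2_def by blast
    have P2: "snd ` P2 \<subseteq> {..4 * r + 2}"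
      using P1 r by (auto simp: P2_def mid_hi_def split: if_splits)
    have rest: "mid_rest r < 4 * r + 3"
      using r by (auto simp: mid_rest_def)
    note second = block_second_half_exceptional[OF st7 rest P2 a4 a5 a6]
    define P3 where "P3 = insert (mid_rest r, 4 * r + 3) P2"
    have "block_values r"
      unfolding block_values_def l_def[symmetric] if_P[OF True]
      using first middle second value5 by blast
    moreover have "block_ends r"
      using first middle second True by (intro ends) auto
    moreover have "block_invariant (r + 1) P3"
    proof -
      have "state (12 * r + 12) {4 * r + 4, 4 * r + 5} (8 * r + 10) P3"
        using second unfolding P3_def by blast
      moreover have "snd ` P3 \<subseteq> {..4 * r + 4}"
        using P2 by (fastforce simp: P3_def)
      moreover have "(mid_lo q, mid_hi q) \<notin> P3" if q: "r + 1 \<le> q" "q + 1 \<in> mu_values" for q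
      proof -
        have "mid_hi q \<noteq> mid_hi r"
          using q r by (auto simp: mid_hi_def)
        \<comment> \<open>The larger exponents agree only for \<open>q = 2 r + 1\<close>. There
          \<open>mid_lo q\<close> is 5 for \<open>q = 11\<close>, 7 for \<open>q = 15\<close> and
          \<open>q\<close> otherwise, hence never the 11 or 15 that block \<open>r\<close>
          leaves.\<close>
        moreover have "(mid_lo q, mid_hi q) \<noteq> (mid_rest r, 4 * r + 3)"
          using q r by (auto simp: mid_hi_def mid_lo_def mid_rest_def split: if_splits)
        ultimately show ?thesis
          using mid1[of q] q by (simp add: P3_def P2_def)
      qed
      ultimately show ?thesis
        unfolding block_invariant_def idx if_P[OF True] by blast
    qed
    ultimately show ?thesis
      by blast
  qed
qed

text \<open>The bits 16 and 17 are free after step 48, as required since 4 is a value of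
  \<open>mu\<close>. The only used pairs of the form \<open>(q, 2 q + 1)\<close> with
  \<open>q \<ge> 4\<close> are \<open>(5, 11)\<close> and \<open>(7, 15)\<close>, and for these
  \<open>q\<close> the reserved pairs are \<open>(4, 5)\<close> and \<open>(6, 7)\<close>
  instead.\<close>

lemma block_invariant_4: "\<exists>P. block_invariant 4 P"
proof -
  have "4 \<in> mu_values"
    unfolding mu_values_iff by (intro exI[of _ 2]) simp
  then have "block_invariant 4 {(0,1),(2,3),(0,4),(1,5),(2,6),(3,7),(8,9),(0,10),(1,4),(5,11),(12,13),(2,14),(3,6),(7,15)}"
    using state_48 by (auto simp: block_invariant_def mid_lo_def mid_hi_def)
  then show ?thesis
    by blast
qed

lemma initial_blocks: "block_values 2" "block_values 3"
proof -
  have M: "2 \<in> mu_values" "3 \<in> mu_values" "4 \<in> mu_values"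
    unfolding mu_values_iff
    by (rule exI[of _ 1], simp, rule exI[of _ 0], simp, rule exI[of _ 2], simp)
  then show "block_values 2" "block_values 3"
    by (auto simp: block_values_def two_up_initial_terms initial_terms_def mid_lo_def mid_hi_def mid_rest_def
        intro: exI[of _ 0] exI[of _ 2])
qed

lemma blocks:
  assumes "4 \<le> r"
  shows "(\<exists>P. block_invariant r P) \<and> (\<forall>s \<in> {2..<r}. block_values s) \<and>
     (\<forall>s \<in> {4..<r}. block_ends s)"
  using assms
proof (induction r rule: dec_induct)
  case base
  have "{2..<4} = {2, 3::nat}"
    by auto
  then show ?case
    using block_invariant_4 initial_blocks by auto
next
  case (step r)
  then show ?case
    using block_step[of r] by (auto simp: less_Suc_eq)
qed

lemma block_values: "2 \<le> r \<Longrightarrow> block_values r"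
  using blocks[of "r + 3"] by auto

lemma block_ends: "4 \<le> r \<Longrightarrow> block_ends r"
  using blocks[of "r + 1"] by auto

section \<open>Atoms and their labels\<close>

lemma weight_power [simp]: "weight (2 ^ e) = 1"
  by (simp add: weight_eq)

lemma weight_pair: "u \<noteq> v \<Longrightarrow> weight (2 ^ u + 2 ^ v) = 2"
  by (simp add: weight_eq set_decode_pair)

lemma weight_initial_terms: "n \<le> 48 \<Longrightarrow> weight (two_up n) = card (set (initial_terms ! n))"
  by (simp add: weight_eq two_up_initial_terms)

lemma small_mu_values: "3 \<in> mu_values" "4 \<in> mu_values" "5 \<notin> mu_values"
proof -
  show "3 \<in> mu_values"
    unfolding mu_values_iff by (rule exI[of _ 0]) simp
  show "4 \<in> mu_values"
    unfolding mu_values_iff by (rule exI[of _ 2]) simp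
  show "5 \<notin> mu_values"
    using odd_mu_values[of 5] by auto
qed

text \<open>Blocks 2 and 3 are included, through the list of early atom ends, because the atom
  containing \<open>a(m)\<close> may lie there.\<close>

lemma atom_end_block:
  assumes "2 \<le> r" "1 \<le> i" "i \<le> 12"
  shows "atom_end (12 * r + i) \<longleftrightarrow> i = 12 \<or> i = (if r + 1 \<in> mu_values then 8 else 6)"
proof (cases "4 \<le> r")
  case True
  then show ?thesis
    using block_ends[OF True] assms unfolding block_ends_def by simp
next
  case False
  then have "r = 2 \<or> r = 3"
    using assms by auto
  then show ?thesis
    using small_mu_values atom_end_initial[of "12 * r + i"] assms by auto
qed

lemma atom_end_12: "2 \<le> r \<Longrightarrow> atom_end (12 * r)"
proof (cases "r = 2")
  case False
  assume "2 \<le> r"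
  then show ?thesis
    using atom_end_block[of "r - 1" 12] False by (auto simp: algebra_simps)
qed (simp add: atom_end_initial)

lemma block_weights:
  assumes "2 \<le> r"
  shows "weight (two_up (12 * r + 1)) = 2" "weight (two_up (12 * r + 2)) = 1"
    "weight (two_up (12 * r + 3)) = 1" "weight (two_up (12 * r + 4)) = 1"
    "weight (two_up (12 * r + 5)) = 2" "weight (two_up (12 * r + 6)) = 1"
    "weight (two_up (12 * r + 7)) = 2" "weight (two_up (12 * r + 8)) = 1"
    "weight (two_up (12 * r + 9)) = (if r + 1 \<in> mu_values then 2 else 1)"
    "weight (two_up (12 * r + 10)) = 1"
    "weight (two_up (12 * r + 11)) = (if r + 1 \<in> mu_values then 1 else 2)"
    "weight (two_up (12 * r + 12)) = 1"
proof -
  note bv = block_values[OF assms, unfolded block_values_def]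
  have "mid_lo r \<noteq> mid_hi r" "mid_rest r \<noteq> 4 * r + 3" "4 * r \<noteq> 4 * r + 1" "2 * r \<noteq> 4 * r + 1"
    "2 * r + 1 \<noteq> 4 * r + 3"
    using assms by (auto simp: mid_lo_def mid_hi_def mid_rest_def)
  note w = this[THEN weight_pair]
  show "weight (two_up (12 * r + 1)) = 2" "weight (two_up (12 * r + 2)) = 1"
    "weight (two_up (12 * r + 3)) = 1" "weight (two_up (12 * r + 4)) = 1"
    "weight (two_up (12 * r + 6)) = 1" "weight (two_up (12 * r + 8)) = 1"
    "weight (two_up (12 * r + 12)) = 1" "weight (two_up (12 * r + 7)) = 2"
    "weight (two_up (12 * r + 9)) = (if r + 1 \<in> mu_values then 2 else 1)"
    "weight (two_up (12 * r + 10)) = 1"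
    using bv w by (simp_all only: weight_power split: if_split) (simp_all split: if_splits)
  obtain u where "u < 4 * r + 2" "two_up (12 * r + 5) = 2 ^ u + 2 ^ (4 * r + 2)"
    using bv by blast
  then show "weight (two_up (12 * r + 5)) = 2"
    using weight_pair[of u "4 * r + 2"] by simp
  show "weight (two_up (12 * r + 11)) = (if r + 1 \<in> mu_values then 1 else 2)"
  proof (cases "r + 1 \<in> mu_values")
    case False
    then obtain z where "z < 2 * r + 2" "two_up (12 * r + 11) = 2 ^ z + 2 ^ (4 * r + 4)"
      using bv by auto
    then show ?thesis
      using False weight_pair[of z "4 * r + 4"] by simp
  qed (use bv in simp)
qed

text \<open>These weights supply the \<open>F\<close> symbols of block \<open>r\<close>.\<close>

lemma half_block_weights:
  assumes "2 \<le> r"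
  shows "weight (two_up (6 * r + 1)) = 2" "weight (two_up (6 * r + 2)) = 1"
    "weight (two_up (6 * r + 3)) = (if r + 1 \<in> mu_values then 2 else 1)"
    "weight (two_up (6 * r + 4)) = 1"
    "weight (two_up (6 * r + 5)) = (if r + 1 \<in> mu_values then 1 else 2)"
    "weight (two_up (6 * r + 6)) = 1"
proof -
  have *: "weight (two_up (6 * r + 1)) = 2 \<and> weight (two_up (6 * r + 2)) = 1 \<and>
    weight (two_up (6 * r + 3)) = (if r + 1 \<in> mu_values then 2 else 1) \<and>
    weight (two_up (6 * r + 4)) = 1 \<and>
    weight (two_up (6 * r + 5)) = (if r + 1 \<in> mu_values then 1 else 2) \<and>
    weight (two_up (6 * r + 6)) = 1"
  proof (cases "4 \<le> r")
    case False
    then have "r = 2 \<or> r = 3"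
      using assms by auto
    then show ?thesis
      using small_mu_values by (auto simp: weight_initial_terms initial_terms_def)
  next
    case True
    show ?thesis
    proof (cases "even r")
      case True
      then obtain s where s: "r = 2 * s"
        by (elim evenE)
      have "r + 1 \<notin> mu_values"
        using odd_mu_values[of "r + 1"] True \<open>4 \<le> r\<close> by auto
      moreover have "6 * r = 12 * s" "2 \<le> s"
        using s \<open>4 \<le> r\<close> by simp_all
      ultimately show ?thesis
        using block_weights[of s] by simp
    next
      case False
      then obtain s where s: "r = 2 * s + 1"
        by (elim oddE)
      have M: "r + 1 \<in> mu_values \<longleftrightarrow> s + 1 \<in> mu_values"
        using double_mu_values_iff[of "s + 1"] by (simp add: s)
      have idx: "6 * r + 1 = 12 * s + 7" "6 * r + 2 = 12 * s + 8" "6 * r + 3 = 12 * s + 9"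
        "6 * r + 4 = 12 * s + 10" "6 * r + 5 = 12 * s + 11" "6 * r + 6 = 12 * s + 12"
        using s by simp_all
      have "2 \<le> s"
        using s \<open>4 \<le> r\<close> by simp
      then show ?thesis
        unfolding idx M using block_weights[of s] by blast
    qed
  qed
  then show "weight (two_up (6 * r + 1)) = 2" "weight (two_up (6 * r + 2)) = 1"
    "weight (two_up (6 * r + 3)) = (if r + 1 \<in> mu_values then 2 else 1)"
    "weight (two_up (6 * r + 4)) = 1"
    "weight (two_up (6 * r + 5)) = (if r + 1 \<in> mu_values then 1 else 2)"
    "weight (two_up (6 * r + 6)) = 1"
    by blast+
qed

section \<open>Codes and the atoms of type \<open>W\<close>\<close>

lemma atom_code_two:
  assumes "2 * t + 2 \<le> q"
  shows "atom_code (2 * t + 1) q = A (weight (two_up (2 * t + 1))) # A (weight (two_up (2 * t + 2))) #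
    F (weight (two_up (t + 1))) # atom_code (2 * (t + 1) + 1) q"
proof -
  have "[2 * t + 1..<q + 1] = (2 * t + 1) # (2 * t + 2) # [2 * (t + 1) + 1..<q + 1]"
    using assms by (simp add: upt_conv_Cons)
  then show ?thesis
    by (simp add: atom_code_def)
qed

lemma atom_code_empty: "q < p \<Longrightarrow> atom_code p q = []"
  by (simp add: atom_code_def)

lemma atom_code_single: "atom_code (2 * t + 1) (2 * t + 1) = [A (weight (two_up (2 * t + 1)))]"
  by (simp add: atom_code_def)

text \<open>The first two \<open>F\<close> symbols suffice to reject all wrong starts later on,
  whatever the last index \<open>q\<close> is. If \<open>q\<close> is too small for two of them to
  occur, the code is shorter than \<open>code_W\<close>.\<close>

lemma atom_code_eq_W:
  assumes "atom_code (2 * t + 1) q = code_W"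
  shows "weight (two_up (t + 1)) = 1 \<and> weight (two_up (t + 2)) = 2"
proof -
  consider "q \<le> 2 * t" | "q = 2 * t + 1" | "q = 2 * t + 2" | "q = 2 * t + 3" | "2 * (t + 1) + 2 \<le> q"
  proof -
    have "q \<le> 2 * t \<or> q = 2 * t + 1 \<or> q = 2 * t + 2 \<or> q = 2 * t + 3 \<or> 2 * (t + 1) + 2 \<le> q"
      by arith
    then show ?thesis
      using that by blast
  qed
  then show ?thesis
  proof cases
    case 1
    then show ?thesis
      using assms by (simp add: atom_code_empty code_W_def)
  next
    case 2
    then show ?thesis
      using assms by (simp only: atom_code_single) (simp add: code_W_def)
  next
    case 3
    then show ?thesis
      using assms atom_code_two[of t q] by (simp add: code_W_def atom_code_empty)
  next
    case 4
    then have q: "q = 2 * (t + 1) + 1" and le: "2 * t + 2 \<le> q"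
      by simp_all
    have "atom_code (2 * (t + 1) + 1) q = [A (weight (two_up (2 * (t + 1) + 1)))]"
      unfolding q by (rule atom_code_single)
    then have "length (atom_code (2 * t + 1) q) = 4"
      using atom_code_two[OF le] by simp
    then show ?thesis
      using assms by (simp add: code_W_def)
  next
    case 5
    then have le: "2 * t + 2 \<le> q"
      by simp
    note code = atom_code_two[OF le, unfolded atom_code_two[OF 5]]
    have "weight (two_up (t + 1)) = 1" "weight (two_up (t + 1 + 1)) = 2"
      using assms unfolding code code_W_def list.inject code_symbol.inject by blast+
    moreover have "t + 1 + 1 = t + 2"
      by simp
    ultimately show ?thesis
      by metis
  qed
qed

lemma atom_code_6:
  "atom_code (2 * t + 1) (2 * t + 6) =
    [A (weight (two_up (2 * t + 1))), A (weight (two_up (2 * t + 2))), F (weight (two_up (t + 1))),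
     A (weight (two_up (2 * t + 3))), A (weight (two_up (2 * t + 4))), F (weight (two_up (t + 2))),
     A (weight (two_up (2 * t + 5))), A (weight (two_up (2 * t + 6))), F (weight (two_up (t + 3)))]"
  using atom_code_two[of t "2 * t + 6"] atom_code_two[of "t + 1" "2 * t + 6"]
    atom_code_two[of "t + 2" "2 * t + 6"]
  by (simp add: atom_code_empty eval_nat_numeral)

lemma atom_code_8:
  "atom_code (2 * t + 1) (2 * t + 8) =
    [A (weight (two_up (2 * t + 1))), A (weight (two_up (2 * t + 2))), F (weight (two_up (t + 1))),
     A (weight (two_up (2 * t + 3))), A (weight (two_up (2 * t + 4))), F (weight (two_up (t + 2))),
     A (weight (two_up (2 * t + 5))), A (weight (two_up (2 * t + 6))), F (weight (two_up (t + 3))),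
     A (weight (two_up (2 * t + 7))), A (weight (two_up (2 * t + 8))), F (weight (two_up (t + 4)))]"
  using atom_code_two[of t "2 * t + 8"] atom_code_two[of "t + 1" "2 * t + 8"]
    atom_code_two[of "t + 2" "2 * t + 8"] atom_code_two[of "t + 3" "2 * t + 8"]
  by (simp add: atom_code_empty eval_nat_numeral)

text \<open>\<open>12 r + i\<close> is the end of the preceding atom; \<open>i = 0\<close> stands
  for the end of the preceding block.\<close>

lemma is_atom_block:
  assumes r: "2 \<le> r" and "i < k" "k \<le> 12" "atom_end (12 * r + i)" "atom_end (12 * r + k)"
    and "\<And>l. i < l \<Longrightarrow> l < k \<Longrightarrow> l \<noteq> (if r + 1 \<in> mu_values then 8 else 6)"
    and "p = 12 * r + i + 1"
  shows "is_atom p (12 * r + k)"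
proof -
  have "\<not> atom_end l" if "l \<in> {p..<12 * r + k}" for l
  proof -
    have "12 * r \<le> l"
      using that assms by simp
    then obtain d where d: "l = 12 * r + d"
      using le_Suc_ex by blast
    then have "i < d" "d < k"
      using that assms by auto
    then show ?thesis
      using atom_end_block[OF r, of d] assms d by auto
  qed
  then show ?thesis
    using assms by (auto simp: is_atom_def)
qed

lemma atom_W:
  assumes "2 \<le> r" "r + 1 \<notin> mu_values"
  shows "atom_of_code code_W (12 * r + 7) (12 * r + 12)"
proof -
  have "is_atom (12 * r + 7) (12 * r + 12)"
    using assms by (intro is_atom_block[where i = 6]) (auto simp: atom_end_block)
  moreover have "2 * (6 * r + 3) + 1 = 12 * r + 7" "2 * (6 * r + 3) + 6 = 12 * r + 12"
    by simp_all
  moreover have "atom_code (2 * (6 * r + 3) + 1) (2 * (6 * r + 3) + 6) = code_W"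
    unfolding atom_code_6 code_W_def
    using half_block_weights[OF assms(1)] block_weights[OF assms(1)] assms(2)
    by (simp add: algebra_simps)
  ultimately show ?thesis
    unfolding atom_of_code_def by metis
qed

lemma atom_V:
  assumes "2 \<le> r" "r + 1 \<notin> mu_values"
  shows "atom_of_code code_V (12 * r + 1) (12 * r + 6)"
proof -
  have "is_atom (12 * r + 1) (12 * r + 6)"
    using assms by (intro is_atom_block[where i = 0]) (auto simp: atom_end_block atom_end_12)
  moreover have "2 * (6 * r) + 1 = 12 * r + 1" "2 * (6 * r) + 6 = 12 * r + 6"
    by simp_all
  moreover have "atom_code (2 * (6 * r) + 1) (2 * (6 * r) + 6) = code_V"
    unfolding atom_code_6 code_V_def
    using half_block_weights[OF assms(1)] block_weights[OF assms(1)] assms(2)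
    by (simp add: algebra_simps)
  ultimately show ?thesis
    unfolding atom_of_code_def by metis
qed

lemma atom_X:
  assumes "2 \<le> r" "r + 1 \<in> mu_values"
  shows "atom_of_code code_X (12 * r + 1) (12 * r + 8)"
proof -
  have "is_atom (12 * r + 1) (12 * r + 8)"
    using assms by (intro is_atom_block[where i = 0]) (auto simp: atom_end_block atom_end_12)
  moreover have "2 * (6 * r) + 1 = 12 * r + 1" "2 * (6 * r) + 8 = 12 * r + 8"
    by simp_all
  moreover have "atom_code (2 * (6 * r) + 1) (2 * (6 * r) + 8) = code_X"
    unfolding atom_code_8 code_X_def
    using half_block_weights[OF assms(1)] block_weights[OF assms(1)] assms(2)
    by (simp add: algebra_simps)
  ultimately show ?thesis
    unfolding atom_of_code_def by metis
qed

lemma first_atom_W: "atom_of_code code_W 15 20"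
proof -
  have "is_atom 15 20"
  proof -
    have "\<not> atom_end i" if "i \<in> {15..<20}" for i
      using that atom_end_initial[of i] by auto
    then show ?thesis
      unfolding is_atom_def using atom_end_initial[of 14] atom_end_initial[of 20] by simp
  qed
  moreover have "atom_code (2 * 7 + 1) (2 * 7 + 6) = code_W"
    unfolding atom_code_6 code_W_def by (simp add: weight_initial_terms initial_terms_def)
  ultimately show ?thesis
    by (simp add: atom_of_code_def)
qed

text \<open>A start follows an atom end. At the start of a block the first \<open>F\<close> symbol
  is 2, since \<open>a(6 r + 1)\<close> has weight two; after position 8 of an exceptional block the
  second \<open>F\<close> symbol is 1. There remain position 7 of regular blocks and, among the
  starts up to 48, the index 15.\<close>

lemma atom_W_start:
  assumes W: "atom_of_code code_W p q"
  shows "p = 15 \<or> (\<exists>r \<ge> 4. r + 1 \<notin> mu_values \<and> p = 12 * r + 7)"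
proof -
  have code: "weight (two_up (t + 1)) = 1" "weight (two_up (t + 2)) = 2" if "p = 2 * t + 1" for t
    using W atom_code_eq_W[of t q] that unfolding atom_of_code_def by blast+
  have no_block_start: "p \<noteq> 12 * r + 1" if "2 \<le> r" for r
    using code(1)[of "6 * r"] half_block_weights(1)[OF that] by auto
  have start: "p = 1 \<or> 1 < p \<and> atom_end (p - 1)"
    using W by (auto simp: atom_of_code_def is_atom_def atom_end_def)
  show ?thesis
  proof (cases "p \<le> 48")
    case True
    have "p = 1 \<or> p \<in> Suc ` {4, 8, 14, 20, 24, 32, 36, 44, 48}"
      using start
    proof
      assume "1 < p \<and> atom_end (p - 1)"
      then show ?thesis
        using True atom_end_initial[of "p - 1"]
        by (intro disjI2 image_eqI[of _ _ "p - 1"]) auto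
    qed simp
    then have "p \<in> {1, 5, 9, 15, 21, 25, 33, 37, 45}"
      using True by auto
    then show ?thesis
      using code[of 0] code[of 2] code[of 4] code[of 10] code[of 12] code[of 16] code[of 18] code[of 22]
      by (auto simp: weight_initial_terms initial_terms_def)
  next
    case False
    \<comment> \<open>The shift by 2 gives \<open>p - 1 = 12 r + i\<close> with \<open>i\<close>
      from 1 to 12, so the preceding atom end lies in block \<open>r\<close> even when
      \<open>p\<close> opens block \<open>r + 1\<close>.\<close>
    define r where "r = (p - 2) div 12"
    define i where "i = (p - 2) mod 12 + 1"
    have p: "p = 12 * r + i + 1"
      using False by (simp add: r_def i_def)
    have i: "1 \<le> i" "i \<le> 12"
      by (auto simp: i_def intro: Suc_leI)
    have "3 \<le> r"
      using False p i by linarith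
    then have "i = 12 \<or> i = (if r + 1 \<in> mu_values then 8 else 6)"
      using start p i atom_end_block[of r i] by auto
    moreover have "i \<noteq> 12"
      using no_block_start[of "r + 1"] p \<open>3 \<le> r\<close> by auto
    moreover have "i \<noteq> 8"
    proof
      assume "i = 8"
      then have "weight (two_up (6 * r + 4 + 2)) = 2"
        using p by (intro code(2)) simp
      moreover have "6 * r + 4 + 2 = 6 * r + 6"
        by simp
      moreover have "weight (two_up (6 * r + 6)) = 1"
        using \<open>3 \<le> r\<close> by (intro half_block_weights(6)) simp
      ultimately have "(2::nat) = 1"
        by metis
      then show False
        by simp
    qed
    ultimately have "i = 6" "r + 1 \<notin> mu_values"
      by (auto split: if_splits)
    moreover from this have "r \<noteq> 3"
      using small_mu_values by auto
    ultimately show ?thesis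
      using p \<open>3 \<le> r\<close> by (intro disjI2 exI[of _ r]) auto
  qed
qed

section \<open>The values of \<open>mu\<close> in increasing order\<close>

lemma infinite_mu_values: "infinite mu_values"
proof -
  have "infinite (range (\<lambda>i. (2::nat) ^ i))"
    by (intro range_inj_infinite) (simp add: inj_on_def)
  moreover have "range (\<lambda>i. (2::nat) ^ i) \<subseteq> mu_values"
    by (auto simp: mu_values_iff)
  ultimately show ?thesis
    using finite_subset by blast
qed

lemma mu_eq: "mu m = enumerate mu_values (m - 1)"
  by (simp only: mu_def mu_values_def)

lemma mu_Suc: "1 \<le> m \<Longrightarrow> mu (Suc m) = (LEAST s. s \<in> mu_values \<and> mu m < s)"
  using enumerate_Suc''[OF infinite_mu_values, of "m - 1"]
  by (simp add: mu_eq)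

lemma mu_in: "mu m \<in> mu_values"
  using enumerate_in_set[OF infinite_mu_values] by (simp add: mu_eq)

lemma mu_Suc_le: "1 \<le> m \<Longrightarrow> s \<in> mu_values \<Longrightarrow> mu m < s \<Longrightarrow> mu (Suc m) \<le> s"
  unfolding mu_Suc by (rule Least_le) simp

lemma mu_less_Suc: "1 \<le> m \<Longrightarrow> mu m < mu (Suc m)"
  using enumerate_step[OF infinite_mu_values, of "m - 1"]
  by (simp add: mu_eq)

lemma mu_1: "mu 1 = 1"
proof -
  have "mu 1 = (LEAST s. s \<in> mu_values)"
    by (simp add: mu_eq enumerate_0)
  also have "\<dots> = 1"
    by (rule Least_equality) (auto simp: mu_values_iff intro: exI[of _ 0])
  finally show ?thesis .
qed

text \<open>Strictly between \<open>2 ^ (i + 1)\<close> and \<open>2 ^ (i + 2)\<close> the only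
  value is \<open>3 * 2 ^ i\<close>. Thus the two kinds alternate, and the induction climbs two
  indices at a time.\<close>

lemma mu_closed: "mu (2 * i + 2) = 2 ^ (i + 1) \<and> mu (2 * i + 3) = 3 * 2 ^ i"
proof -
  have odd_step: "mu (Suc m) = 3 * 2 ^ i" if "mu m = 2 ^ (i + 1)" "1 \<le> m" for m i
    unfolding mu_Suc[OF that(2)] that(1)
  proof (rule Least_equality)
    show "3 * 2 ^ i \<in> mu_values \<and> (2::nat) ^ (i + 1) < 3 * 2 ^ i"
      by (auto simp: mu_values_iff)
    fix s assume s: "s \<in> mu_values \<and> (2::nat) ^ (i + 1) < s"
    then consider j where "s = 2 ^ j" | j where "s = 3 * 2 ^ j"
      by (auto simp: mu_values_iff)
    then show "3 * 2 ^ i \<le> s"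
    proof cases
      case 1
      then have "i + 1 < j"
        using s power_less_imp_less_exp[of "2::nat" "i + 1" j] by auto
      then have "(2::nat) ^ (i + 2) \<le> 2 ^ j"
        by (intro power_increasing) auto
      then show ?thesis
        using 1 by simp
    next
      case 2
      have "i \<le> j"
      proof (rule ccontr)
        assume "\<not> i \<le> j"
        then have "(2::nat) ^ (j + 1) \<le> 2 ^ i"
          by (intro power_increasing) auto
        then show False
          using s 2 by simp
      qed
      then show ?thesis
        using 2 by simp
    qed
  qed
  have even_step: "mu (Suc m) = 2 ^ (i + 2)" if "mu m = 3 * 2 ^ i" "1 \<le> m" for m i
    unfolding mu_Suc[OF that(2)] that(1)
  proof (rule Least_equality)
    show "2 ^ (i + 2) \<in> mu_values \<and> (3::nat) * 2 ^ i < 2 ^ (i + 2)"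
      unfolding mu_values_iff by (intro conjI exI[of _ "i + 2"]) simp_all
    fix s assume s: "s \<in> mu_values \<and> (3::nat) * 2 ^ i < s"
    then consider j where "s = 2 ^ j" | j where "s = 3 * 2 ^ j"
      by (auto simp: mu_values_iff)
    then show "2 ^ (i + 2) \<le> s"
    proof cases
      case 1
      have "i + 2 \<le> j"
      proof (rule ccontr)
        assume "\<not> i + 2 \<le> j"
        then have "(2::nat) ^ j \<le> 2 ^ (i + 1)"
          by (intro power_increasing) auto
        then show False
          using s 1 by simp
      qed
      then show ?thesis
        unfolding 1 by (intro power_increasing) auto
    next
      case 2
      then have "i < j"
        using s by simp
      then have "(2::nat) ^ (i + 1) \<le> 2 ^ j"
        by (intro power_increasing) auto
      then show ?thesis
        using 2 by simp
    qed
  qed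
  have "mu 2 = 2"
  proof -
    have "mu (Suc 1) = 2"
      unfolding mu_Suc[OF order_refl] mu_1
      by (rule Least_equality) (auto simp: mu_values_iff intro: exI[of _ 1])
    then show ?thesis
      by (simp add: numeral_2_eq_2)
  qed
  then show ?thesis
  proof (induction i)
    case 0
    then show ?case
      using odd_step[of 2 0] by (simp add: eval_nat_numeral)
  next
    case (Suc i)
    then have "mu (2 * i + 3) = 3 * 2 ^ i"
      by simp
    from even_step[OF this] have e: "mu (2 * Suc i + 2) = 2 ^ (Suc i + 1)"
      by (simp add: eval_nat_numeral)
    with odd_step[OF this] show ?case
      by (simp add: eval_nat_numeral)
  qed
qed

text \<open>The gap is one more than the number of labels with first component \<open>k\<close>:
  these labels stand for all \<open>r\<close> from \<open>mu (k + 4)\<close> up to, but not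
  including, the exceptional \<open>mu (k + 5) - 1\<close>.\<close>

lemma mu_gap: "mu (k + 5) = mu (k + 4) + 2 ^ (k div 2 + 1)"
proof (cases "even k")
  case True
  then obtain i where k: "k = 2 * i"
    by (elim evenE)
  then have idx: "k + 4 = 2 * (i + 1) + 2" "k + 5 = 2 * (i + 1) + 3"
    by simp_all
  show ?thesis
    unfolding idx using mu_closed[of "i + 1"] by (simp add: k)
next
  case False
  then obtain i where k: "k = 2 * i + 1"
    by (elim oddE)
  then have idx: "k + 4 = 2 * (i + 1) + 3" "k + 5 = 2 * (i + 2) + 2"
    by simp_all
  show ?thesis
    unfolding idx using mu_closed[of "i + 1"] mu_closed[of "i + 2"] by (simp add: k)
qed

lemma mu_4: "mu 4 = 4"
  using mu_closed[of 1] by simp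

lemma mu_mono: "k \<le> k' \<Longrightarrow> mu (k + 4) \<le> mu (k' + 4)"
  by (rule lift_Suc_mono_le[of "\<lambda>k. mu (k + 4)"]) (use mu_gap in \<open>auto simp: eval_nat_numeral\<close>)

section \<open>Labels as an enumeration of the regular blocks\<close>

lemma label_bounds:
  assumes "(k, j) \<in> W_labels"
  shows "4 \<le> mu (k + 4) + j" "mu (k + 4) + j + 1 < mu (k + 5)" "mu (k + 4) + j + 1 \<notin> mu_values"
proof -
  show "4 \<le> mu (k + 4) + j"
    using mu_mono[of 0 k] mu_4 by simp
  have "j \<le> 2 ^ (k div 2 + 1) - 2"
    using assms by (simp add: W_labels_def)
  moreover have "(2::nat) \<le> 2 ^ (k div 2 + 1)"
    by simp
  ultimately show lt: "mu (k + 4) + j + 1 < mu (k + 5)"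
    unfolding mu_gap by linarith
  show "mu (k + 4) + j + 1 \<notin> mu_values"
    using mu_Suc_le[of "k + 4" "mu (k + 4) + j + 1"] lt by (auto simp: eval_nat_numeral)
qed

lemma label_less:
  assumes "(k, j) \<in> W_labels" "k < k'"
  shows "mu (k + 4) + j < mu (k' + 4) + j'"
  using label_bounds(2)[OF assms(1)] mu_mono[of "k + 1" k'] assms(2)
  by (simp add: eval_nat_numeral)

lemma label_exists:
  assumes "4 \<le> x" "x + 1 \<notin> mu_values"
  shows "\<exists>(k, j) \<in> W_labels. x = mu (k + 4) + j"
proof -
  have unbounded: "k \<le> mu (k + 4)" for k
  proof (induction k)
    case (Suc k)
    then show ?case
      using mu_less_Suc[of "k + 4"] by simp
  qed simp
  \<comment> \<open>Minimality places \<open>x\<close> in the interval from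
    \<open>mu (k + 4)\<close> to \<open>mu (k + 5)\<close>; its lower end is \<open>mu 4 = 4\<close>
    if \<open>k = 0\<close>.\<close>
  define k where "k = (LEAST k. x < mu (k + 5))"
  have "x < mu (x + 5)"
    using unbounded[of x] mu_less_Suc[of "x + 4"] by (simp add: eval_nat_numeral)
  then have k: "x < mu (k + 5)"
    unfolding k_def by (rule LeastI)
  have "mu (k + 4) \<le> x"
  proof (cases k)
    case 0
    then show ?thesis
      using assms(1) mu_4 by simp
  next
    case (Suc l)
    then have "\<not> x < mu (l + 5)"
      unfolding k_def using not_less_Least[of l "\<lambda>k. x < mu (k + 5)"] by simp
    then show ?thesis
      using Suc by (simp add: eval_nat_numeral)
  qed
  have "x + 1 \<noteq> mu (k + 5)"
    using mu_in assms(2) by metis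
  then have "x - mu (k + 4) \<le> 2 ^ (k div 2 + 1) - 2"
    using k \<open>mu (k + 4) \<le> x\<close> unfolding mu_gap by linarith
  then show ?thesis
    using \<open>mu (k + 4) \<le> x\<close>
    by (intro bexI[of _ "(k, x - mu (k + 4))"]) (auto simp: W_labels_def)
qed

text \<open>The intervals for successive \<open>k\<close> are disjoint and increasing, so
  lexicographic order of labels is numerical order of block numbers. Counting labels thereby becomes
  counting regular blocks.\<close>

lemma bij_betw_labels_before:
  assumes "(k, j) \<in> W_labels"
  shows "bij_betw (\<lambda>(k, j). mu (k + 4) + j) (labels_before k j)
    {x. 4 \<le> x \<and> x < mu (k + 4) + j \<and> x + 1 \<notin> mu_values}"
proof (rule bij_betwI')
  fix a b assume "a \<in> labels_before k j" "b \<in> labels_before k j"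
  then have ab: "(fst a, snd a) \<in> W_labels" "(fst b, snd b) \<in> W_labels"
    by (auto simp: labels_before_def)
  show "((case a of (k, j) \<Rightarrow> mu (k + 4) + j) = (case b of (k, j) \<Rightarrow> mu (k + 4) + j)) \<longleftrightarrow> a = b"
    using label_less[OF ab(1), of "fst b" "snd b"] label_less[OF ab(2), of "fst a" "snd a"]
    by (cases "fst a" "fst b" rule: linorder_cases) (auto simp: case_prod_beta prod_eq_iff)
next
  fix a assume a: "a \<in> labels_before k j"
  obtain k' j' where kj: "a = (k', j')"
    by fastforce
  have "(k', j') \<in> W_labels" "k' < k \<or> k' = k \<and> j' < j"
    using a kj by (auto simp: labels_before_def)
  then show "(case a of (k, j) \<Rightarrow> mu (k + 4) + j) \<in>
      {x. 4 \<le> x \<and> x < mu (k + 4) + j \<and> x + 1 \<notin> mu_values}"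
    using label_bounds[of k' j'] label_less[of k' j' k j] kj by auto
next
  fix x assume x: "x \<in> {x. 4 \<le> x \<and> x < mu (k + 4) + j \<and> x + 1 \<notin> mu_values}"
  then obtain k' j' where kj: "(k', j') \<in> W_labels" "x = mu (k' + 4) + j'"
    using label_exists[of x] by auto
  then have "\<not> k < k'"
    using label_less[OF assms, of k' j'] x by auto
  then have "(k', j') \<in> labels_before k j"
    using kj x by (auto simp: labels_before_def)
  then show "\<exists>a \<in> labels_before k j. x = (case a of (k, j) \<Rightarrow> mu (k + 4) + j)"
    using kj by force
qed

text \<open>The earlier starts are 15, which is \<open>W(-1)\<close> and gives the summand 1, and
  one start \<open>12 x + 7\<close> for each earlier regular block \<open>x \<ge> 4\<close>.\<close>

lemma W_atom_label:
  assumes "(k, j) \<in> W_labels" and r: "r = mu (k + 4) + j"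
  shows "W_atom k j (12 * r + 7) (12 * r + 12)"
proof -
  note lab = label_bounds[OF assms(1), folded r]
  define B where "B = {x. 4 \<le> x \<and> x < r \<and> x + 1 \<notin> mu_values}"
  have "{p'. p' < 12 * r + 7 \<and> (\<exists>q'. atom_of_code code_W p' q')} = insert 15 ((\<lambda>x. 12 * x + 7) ` B)"
    (is "?L = ?R")
  proof (intro subset_antisym subsetI)
    fix p assume "p \<in> ?L"
    then obtain q where less: "p < 12 * r + 7" and "atom_of_code code_W p q"
      by blast
    from atom_W_start[OF this(2)] show "p \<in> ?R"
    proof (elim disjE exE conjE)
      fix s assume "4 \<le> s" "s + 1 \<notin> mu_values" "p = 12 * s + 7"
      then show ?thesis
        using less by (simp add: B_def)
    qed simp
  next
    fix p assume "p \<in> ?R"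
    then consider "p = 15" | s where "s \<in> B" "p = 12 * s + 7"
      by blast
    then show "p \<in> ?L"
    proof cases
      case 1
      then show ?thesis
        using first_atom_W lab(1) by auto
    next
      case 2
      then have "atom_of_code code_W p (12 * s + 12)"
        using atom_W[of s] by (simp add: B_def)
      then show ?thesis
        using 2 by (auto simp: B_def)
    qed
  qed
  moreover have "finite B"
    by (simp add: B_def)
  moreover have "card ((\<lambda>x. 12 * x + 7) ` B) = card B"
    by (intro card_image inj_onI) simp
  moreover have "15 \<notin> (\<lambda>x. 12 * x + 7) ` B"
    by (auto simp: B_def)
  moreover have "card (labels_before k j) = card B"
    using bij_betw_labels_before[OF assms(1)] bij_betw_same_card unfolding B_def r by blast
  ultimately have "card {p'. p' < 12 * r + 7 \<and> (\<exists>q'. atom_of_code code_W p' q')} =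
      1 + card (labels_before k j)"
    by simp
  then show ?thesis
    using atom_W[of r] lab by (simp add: W_atom_def)
qed

text \<open>For \<open>r = 2 s\<close> the index is \<open>12 s + 5\<close>, inside the first atom
  of block \<open>s\<close>, a \<open>V\<close> or an \<open>X\<close>. For
  \<open>r = 2 s + 1\<close> it is \<open>12 s + 11\<close>, inside the \<open>W\<close> of block
  \<open>s\<close>.\<close>

lemma half_position_in_atom:
  assumes "4 \<le> r" "r + 1 \<notin> mu_values"
  shows "\<exists>p q. (atom_of_code code_V p q \<or> atom_of_code code_W p q \<or> atom_of_code code_X p q) \<and>
    p \<le> 6 * r + 5 \<and> 6 * r + 5 \<le> q \<and> q < 12 * r + 7"
proof (cases "even r")
  case True
  then obtain s where s: "r = 2 * s" "2 \<le> s"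
    using assms(1) by (auto elim: evenE)
  show ?thesis
  proof (cases "s + 1 \<in> mu_values")
    case True
    then show ?thesis
      using atom_X[of s] s by (intro exI[of _ "12 * s + 1"] exI[of _ "12 * s + 8"]) auto
  next
    case False
    then show ?thesis
      using atom_V[of s] s by (intro exI[of _ "12 * s + 1"] exI[of _ "12 * s + 6"]) auto
  qed
next
  case False
  then obtain s where s: "r = 2 * s + 1"
    by (elim oddE)
  then have "s + 1 \<notin> mu_values" "2 \<le> s"
    using assms double_mu_values_iff[of "s + 1"] by auto
  then show ?thesis
    using atom_W[of s] s by (intro exI[of _ "12 * s + 7"] exI[of _ "12 * s + 12"]) auto
qed

theorem theorem6p4:
  fixes k j n m :: nat
  assumes "j \<le> 2 ^ (k div 2 + 1) - 2"
    and "n = 12 * mu (k + 4) + 12 * j + 7"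
    and "m = (n + 3) div 2"
  shows "W_atom k j n (n + 5) \<and>
    weight (two_up m) = 2 \<and>
    (\<exists>p q. (atom_of_code code_V p q \<or> atom_of_code code_W p q \<or> atom_of_code code_X p q) \<and>
           p \<le> m \<and> m \<le> q \<and> q < n) \<and>
    (\<forall>x y. y < x \<and> two_up m = 2 ^ x + 2 ^ y \<longrightarrow>
       x = 2 * mu (k + 4) + 2 * j + 2 \<and>
       two_up n = 2 ^ (x - 1) + 2 ^ (2 * x - 1) \<and>
       two_up (n + 1) = 2 ^ (4 * x - 2) \<and>
       two_up (n + 2) = 2 ^ (4 * x - 1) \<and>
       two_up (n + 3) = 2 ^ (4 * x) \<and>
       two_up (n + 4) = 2 ^ y + 2 ^ (2 * x) \<and>
       two_up (n + 5) = 2 ^ (4 * x + 1) \<and>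
       two_up (n + 6) = 2 ^ x + 2 ^ (2 * x + 1))"
proof -
  define r where "r = mu (k + 4) + j"
  have lab: "(k, j) \<in> W_labels"
    using assms(1) by (simp add: W_labels_def)
  have r: "4 \<le> r" "r + 1 \<notin> mu_values"
    using label_bounds[OF lab] by (simp_all add: r_def)
  have n: "n = 12 * r + 7" and m: "m = 6 * r + 5"
    using assms by (simp_all add: r_def)
  have idx: "n + 1 = 12 * r + 8" "n + 2 = 12 * r + 9" "n + 3 = 12 * r + 10" "n + 4 = 12 * r + 11"
    "n + 5 = 12 * r + 12" "n + 6 = 12 * (r + 1) + 1"
    by (simp_all add: n)
  have "2 \<le> r" "2 \<le> r + 1"
    using r by simp_all
  \<comment> \<open>The one fact \<open>r + 1 \<notin> mu_values\<close> settles both the second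
    half of block \<open>r\<close> and the first term of block \<open>r + 1\<close>, which is
    \<open>a(n + 6)\<close>.\<close>
  note bv = block_values[OF \<open>2 \<le> r\<close>, unfolded block_values_def if_not_P[OF r(2)]]
    block_values[OF \<open>2 \<le> r + 1\<close>, unfolded block_values_def if_not_P[OF r(2)]]
  obtain z where z: "z < 2 * r + 2" "two_up (6 * r + 5) = 2 ^ z + 2 ^ (2 * r + 2)"
    "two_up (12 * r + 11) = 2 ^ z + 2 ^ (4 * r + 4)"
    using bv(1) by blast
  have "W_atom k j n (n + 5)"
    using W_atom_label[OF lab r_def] unfolding idx(5) unfolding n .
  moreover have "weight (two_up m) = 2"
    using half_block_weights(5)[OF \<open>2 \<le> r\<close>] r by (simp add: m)
  moreover have "x = 2 * mu (k + 4) + 2 * j + 2 \<and>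
       two_up n = 2 ^ (x - 1) + 2 ^ (2 * x - 1) \<and>
       two_up (n + 1) = 2 ^ (4 * x - 2) \<and>
       two_up (n + 2) = 2 ^ (4 * x - 1) \<and>
       two_up (n + 3) = 2 ^ (4 * x) \<and>
       two_up (n + 4) = 2 ^ y + 2 ^ (2 * x) \<and>
       two_up (n + 5) = 2 ^ (4 * x + 1) \<and>
       two_up (n + 6) = 2 ^ x + 2 ^ (2 * x + 1)"
    if "y < x" "two_up m = 2 ^ x + 2 ^ y" for x y
  proof -
    \<comment> \<open>By uniqueness of binary expansions the given \<open>x\<close> and
      \<open>y\<close> can only be \<open>2 r + 2\<close> and \<open>z\<close>.\<close>
    have "(2::nat) ^ z + 2 ^ (2 * r + 2) = 2 ^ y + 2 ^ x"
      using z(2) that(2) by (simp only: m add.commute)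
    then have x: "x = 2 * r + 2" and y: "y = z"
      using power_pair_eq_iff[OF z(1) that(1)] by auto
    have e: "x - 1 = 2 * r + 1" "2 * x - 1 = 4 * r + 3" "4 * x - 2 = 8 * r + 6"
      "4 * x - 1 = 8 * r + 7" "4 * x = 8 * r + 8" "2 * x = 4 * r + 4" "4 * x + 1 = 8 * r + 9"
      "x = 2 * (r + 1)" "2 * x + 1 = 4 * (r + 1) + 1"
      by (simp_all add: x)
    have "x = 2 * mu (k + 4) + 2 * j + 2"
      by (simp add: x r_def)
    moreover have "two_up n = 2 ^ (x - 1) + 2 ^ (2 * x - 1)"
      using bv(1) unfolding n e(1,2) by blast
    moreover have "two_up (n + 1) = 2 ^ (4 * x - 2)"
      using bv(1) unfolding idx e(3) by blast
    moreover have "two_up (n + 2) = 2 ^ (4 * x - 1)"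
      using bv(1) unfolding idx e(4) by blast
    moreover have "two_up (n + 3) = 2 ^ (4 * x)"
      using bv(1) unfolding idx e(5) by blast
    moreover have "two_up (n + 4) = 2 ^ y + 2 ^ (2 * x)"
      using z(3) unfolding idx e(6) y by blast
    moreover have "two_up (n + 5) = 2 ^ (4 * x + 1)"
      using bv(1) unfolding idx e(7) by blast
    moreover have "two_up (n + 6) = 2 ^ x + 2 ^ (2 * x + 1)"
      using bv(2) unfolding idx e(9) unfolding e(8) by blast
    ultimately show ?thesis
      by blast
  qed
  ultimately show ?thesis
    using half_position_in_atom[OF r] unfolding n m by blast
qed

end
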